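(* Let $1<p<\infty$, $1\le q\le\infty$, and $\beta>0$, and let $E\subset X$ be a compact set. Then $$\operatorname{Cap}^\beta_{p,q}(E)^{1/p}=\sup\left\{\frac{\nu(E)}{\big\|\check{\mathcal H}_\beta\nu\big\|_{L^{p'}(X;l^{q'})}}\,:\,\nu\in\mathcal M^+(E)\right\}.$$
   Context: Setting: $X=(X,d,\mu)$ is a metric space with at least two points, with a nonnegative complete Borel measure $\mu$ such that $0<\mu(B)<\infty$ for every open ball $B=B(x,r)=\{y\in X: d(y,x)<r\}$, $x\in X$, $r>0$. The measure $\mu$ is doubling: there is $c_\mu>1$ with $\mu(B(x,2r))\le c_\mu\mu(B(x,r))$ for all balls. $\mathbf 1_A$ is the characteristic function of $A$. Conjugate exponents: $p'=p/(p-1)$ for $1<p<\infty$, and likewise for $q$, with $q'=1$ if $q=\infty$ and $q'=\infty$ if $q=1$. Index $n_0$: $n_0=-\infty$ if $\operatorname{diam}(X)=\infty$; otherwise $n_0$ is the smallest integer with $2^{-n_0}\le 2\operatorname{diam}(X)$. Sums and sequences over $n\ge n_0$ are over integers $n\ge n_0$. Mixed norms: for a sequence $g=(g_n)_{n\ge n_0}$ of measurable functions on $X$, $\|g\|_{L^p(X;l^q)}=\big\|\,\|(g_n)_n\|_{l^q}\,\big\|_{L^p(X)}$, where $\|(g_n)\|_{l^q}=(\sum_n|g_n|^q)^{1/q}$ for $q<\infty$ and $\sup_n|g_n|$ for $q=\infty$. Potential capacity: for a sequence $f=(f_n)_{n\ge n_0}$ of nonnegative Borel functions in $X$ let $$\mathcal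 H_\beta f(x)=\sum_{n=n_0}^\infty 2^{-\beta n}\int_X\frac{\mathbf 1_{B(y,2^{-n})}(x)}{\mu(B(y,2^{-n}))}f_n(y)\,d\mu(y),\qquad x\in X.$$ Then $\operatorname{Cap}^\beta_{p,q}(E)=\inf\|f\|^p_{L^p(X;l^q)}$ over all such sequences $f$ with $\mathcal H_\beta f(x)\ge 1$ for all $x\in E$. Measures: for compact $E\subset X$, $\mathcal M^+(E)$ is the set of nonnegative Radon measures on $E$, i.e. nonnegative Borel measures $\nu$ on $E$ with $\nu(E)<\infty$ such that every Borel $F\subset E$ satisfies $\nu(F)=\inf\{\nu(U):F\subset U,\ U\text{ open in }E\}=\sup\{\nu(K):K\subset F,\ K\text{ compact}\}$. Each $\nu\in\mathcal M^+(E)$ is extended to a Borel measure in $X$ by $\nu(A)=\nu(A\cap E)$. For a nonnegative Borel measure $\nu$ in $X$, $$\check{\mathcal H}_\beta\nu(x)=\left(2^{-\beta n}\frac{\nu(B(x,2^{-n}))}{\mu(B(x,2^{-n}))}\right)_{n=n_0}^\infty,\qquad x\in X.$$ In the quotient, $0/0$ (which occurs for $\nu=0$) is read as $0$, and $a/\infty$ as $0$ for finite $a\geq 0$. *)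

theory Defs
  imports "HOL-Analysis.Analysis"
begin

text \<open>
  The ambient space is the universe of a type of class \<open>metric_space\<close>, and all suprema, infima,
  integrals and norms are taken in \<open>ennreal = [0, \<infinity>]\<close>.
\<close>

text \<open>
  The index set of all integers \<open>n \<ge> n\<^sub>0\<close>. The case distinction is needed because the library's
  \<open>diameter\<close> is only meaningful on bounded sets.
\<close>

definition scales :: "'a::metric_space itself \<Rightarrow> int set" where
  "scales _ = (if bounded (UNIV :: 'a set)
     then {(LEAST n::int. 2 powi (- n) \<le> 2 * diameter (UNIV :: 'a set))..}
     else UNIV)"

text \<open>The power \<open>x\<^sup>a\<close> on \<open>[0, \<infinity>]\<close>, meant for exponents \<open>0 < a < \<infinity>\<close> only.\<close>

definition ennpow :: "ennreal \<Rightarrow> real \<Rightarrow> ennreal" where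
  "ennpow x a = (if x = top then top else ennreal (enn2real x powr a))"

definition Lp_norm :: "'a measure \<Rightarrow> real \<Rightarrow> ('a \<Rightarrow> ennreal) \<Rightarrow> ennreal" where
  "Lp_norm M p h = ennpow (\<integral>\<^sup>+x. ennpow (h x) p \<partial>M) (1 / p)"

text \<open>Sums over \<open>I\<close> are integrals with respect to the counting measure.\<close>

definition lq_norm :: "int set \<Rightarrow> ennreal \<Rightarrow> (int \<Rightarrow> ennreal) \<Rightarrow> ennreal" where
  "lq_norm I q c = (if q = top then (SUP n\<in>I. c n)
     else ennpow (\<integral>\<^sup>+n. ennpow (c n) (enn2real q) \<partial>count_space I) (1 / enn2real q))"

definition mixed_norm ::
    "'a::metric_space measure \<Rightarrow> real \<Rightarrow> ennreal \<Rightarrow> (int \<Rightarrow> 'a \<Rightarrow> ennreal) \<Rightarrow> ennreal" where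
  "mixed_norm M p q g = Lp_norm M p (\<lambda>x. lq_norm (scales TYPE('a)) q (\<lambda>n. g n x))"

definition conj_exponent :: "ennreal \<Rightarrow> ennreal" where
  "conj_exponent q = (if q = top then 1 else if q = 1 then top else q / (q - 1))"

definition pot ::
    "'a::metric_space measure \<Rightarrow> real \<Rightarrow> (int \<Rightarrow> 'a \<Rightarrow> ennreal) \<Rightarrow> 'a \<Rightarrow> ennreal" where
  "pot M \<beta> f x =
     (\<integral>\<^sup>+n. ennreal (2 powr (- \<beta> * real_of_int n)) *
        (\<integral>\<^sup>+y. indicator (ball y (2 powi (- n))) x / emeasure M (ball y (2 powi (- n))) * f n y \<partial>M)
      \<partial>count_space (scales TYPE('a)))"

definition potential_cap ::
    "'a::metric_space measure \<Rightarrow> real \<Rightarrow> real \<Rightarrow> ennreal \<Rightarrow> 'a set \<Rightarrow> ennreal" where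
  "potential_cap M \<beta> p q E =
     (INF f \<in> {f. (\<forall>n\<in>scales TYPE('a). f n \<in> borel_measurable borel) \<and> (\<forall>x\<in>E. 1 \<le> pot M \<beta> f x)}.
        ennpow (mixed_norm M p q f) p)"

text \<open>Elements are measures on the subspace \<open>E\<close>, with the Borel \<open>\<sigma>\<close>-algebra of \<open>E\<close>.\<close>

definition radon_measures :: "'a::metric_space set \<Rightarrow> 'a measure set" where
  "radon_measures E = {\<nu>.
     space \<nu> = E \<and> sets \<nu> = sets (restrict_space borel E) \<and> emeasure \<nu> E < top \<and>
     (\<forall>F\<in>sets \<nu>.
        emeasure \<nu> F = (INF U \<in> {U. F \<subseteq> U \<and> openin (top_of_set E) U}. emeasure \<nu> U) \<and>
        emeasure \<nu> F = (SUP K \<in> {K. K \<subseteq> F \<and> compact K}. emeasure \<nu> K))}"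

text \<open>Extension by zero of a measure on a Borel subspace to a Borel measure on the whole space.\<close>

definition zero_extension :: "'a::metric_space measure \<Rightarrow> 'a measure" where
  "zero_extension \<nu> = distr \<nu> borel (\<lambda>x. x)"

lemma emeasure_zero_extension:
  assumes "\<nu> \<in> radon_measures E" "A \<in> sets borel"
  shows "emeasure (zero_extension \<nu>) A = emeasure \<nu> (A \<inter> E)"
proof -
  have sp: "space \<nu> = E" and st: "sets \<nu> = sets (restrict_space borel E)"
    using assms(1) by (auto simp: radon_measures_def)
  have "(\<lambda>x. x) \<in> measurable (restrict_space borel E) borel"
    by (rule measurable_restrict_space1) simp
  then have "(\<lambda>x. x) \<in> measurable \<nu> borel"
    using measurable_cong_sets[OF st refl] by blast
  then show ?thesis
    using assms(2) sp by (simp add: zero_extension_def emeasure_distr)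
qed

definition dual_pot ::
    "'a::metric_space measure \<Rightarrow> real \<Rightarrow> 'a measure \<Rightarrow> int \<Rightarrow> 'a \<Rightarrow> ennreal" where
  "dual_pot M \<beta> \<nu> n x =
     ennreal (2 powr (- \<beta> * real_of_int n)) *
       (emeasure \<nu> (ball x (2 powi (- n))) / emeasure M (ball x (2 powi (- n))))"

end

theory Submission
  imports Defs "HOL-Probability.Probability"
begin

text \<open>
  If \<open>f\<close> is admissible for \<open>E\<close>, integrating its potential against \<open>\<nu>\<close> and applying Fubini and
  the mixed Hoelder inequality bounds \<open>\<nu>(E)\<close> by the product of the two norms.

  For the converse let \<open>t < Cap(E)\<^sup>1\<^sup>/\<^sup>p\<close>. Keep finitely many scales and shrink the radii \<open>2\<^sup>-\<^sup>n\<close> to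
  \<open>s 2\<^sup>-\<^sup>n\<close> with \<open>s < 1\<close>: a function whose shrunken truncated potential is at least 1 on a fine finite
  net of \<open>E\<close> is admissible for all of \<open>E\<close>, hence has norm at least \<open>t\<close>. On a finite net, separating
  a convex set from an orthant yields a probability measure whose truncated dual potential has norm
  at most \<open>1/t\<close>. As \<open>s \<rightarrow> 1\<close> and the set of scales grows, these measures have a weak limit \<open>\<nu>\<close> on
  \<open>E\<close>; it is obtained from Helly's selection theorem on the real line by coding the points of \<open>E\<close>
  by ternary digits. Since \<open>\<nu>(U)\<close> is at most the lower limit of the approximating masses for open
  \<open>U\<close>, Fatou's lemma gives the bound \<open>1/t\<close> for the norm of the dual potential of \<open>\<nu>\<close>.
\<close>

section \<open>Powers and Lebesgue norms with values in the extended half-line\<close>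

text \<open>The kernel of the potential jumps as the point moves, so a lower bound on a finite net
  does not pass to the rest of \<open>E\<close>, and masses of balls are not continuous under weak
  limits. Shrinking the ball in the numerator only cures the first defect: if a net point
  \<open>i\<close> is within \<open>(1 - s) 2^(-n)\<close> of \<open>x\<close>, the shrunken kernel
  at \<open>i\<close> is at most the full kernel at \<open>x\<close>. One net serves all scales
  because finitely many are kept; this, with doubling to bound the reciprocal masses of balls near a
  net point, also makes the kernels bounded with supports of finite measure, so that pairings are
  real numbers. The second defect is harmless: dual potentials see only open balls, for which the
  inequality surviving a weak limit points the right way, and the shrunken balls exhaust the full
  one as \<open>s\<close> tends to 1. The code of \<open>E\<close> on the line may be discontinuous;
  its inverse is continuous, which suffices since the approximating measures are discrete. For
  \<open>q = 1\<close> the dual norm is a supremum; finitely many scales let it be attained at an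
  index depending measurably on the point.\<close>

lemma ennpow_top [simp]: "ennpow top a = top"
  by (simp add: ennpow_def)

lemma ennpow_ennreal: "0 \<le> x \<Longrightarrow> ennpow (ennreal x) a = ennreal (x powr a)"
  by (simp add: ennpow_def)

lemma ennpow_0 [simp]: "ennpow 0 a = 0"
  by (simp add: ennpow_def)

lemma ennpow_1 [simp]: "ennpow 1 a = 1"
  by (simp add: ennpow_def)

lemma ennpow_one [simp]: "ennpow x 1 = x"
  by (cases x) (auto simp: ennpow_ennreal)

lemma ennpow_mono: "0 \<le> a \<Longrightarrow> x \<le> y \<Longrightarrow> ennpow x a \<le> ennpow y a"
  by (cases x; cases y) (auto simp: ennpow_ennreal top_unique intro!: ennreal_leI powr_mono2)

lemma ennpow_ennpow: "ennpow (ennpow x a) b = ennpow x (a * b)"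
  by (cases x) (auto simp: ennpow_ennreal powr_powr)

lemma ennpow_inverse: "a \<noteq> 0 \<Longrightarrow> ennpow (ennpow x a) (1 / a) = x"
  "a \<noteq> 0 \<Longrightarrow> ennpow (ennpow x (1 / a)) a = x"
  by (simp_all add: ennpow_ennpow)

lemma ennpow_less_iff:
  assumes "0 < a"
  shows "ennpow x a < ennpow y a \<longleftrightarrow> x < y"
proof -
  have "ennpow y a \<le> ennpow x a \<longleftrightarrow> y \<le> x"
    using assms ennpow_mono[of a y x] ennpow_mono[of "1 / a" "ennpow y a" "ennpow x a"]
    by (auto simp: ennpow_inverse)
  then show ?thesis by (simp add: not_le[symmetric])
qed

lemma ennpow_eq_0_iff: "a \<noteq> 0 \<Longrightarrow> ennpow x a = 0 \<longleftrightarrow> x = 0"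
  by (metis ennpow_0 ennpow_inverse(1))

lemma ennpow_eq_top_iff: "ennpow x a = top \<longleftrightarrow> x = top"
  by (cases x) (auto simp: ennpow_ennreal)

lemma ennpow_mult:
  assumes "0 < a" shows "ennpow (x * y) a = ennpow x a * ennpow y a"
proof (cases "x = 0 \<or> y = 0")
  case False
  show ?thesis
  proof (cases "x = top \<or> y = top")
    case True
    then show ?thesis using False assms
      by (auto simp: ennreal_mult_top ennreal_top_mult ennpow_eq_0_iff)
  next
    case False
    then obtain u v where "x = ennreal u" "y = ennreal v" "0 \<le> u" "0 \<le> v"
      by (cases x; cases y) auto
    then show ?thesis
      by (simp add: ennreal_mult[symmetric] ennpow_ennreal powr_mult)
  qed
qed auto

lemma ennpow_add:
  assumes "0 < a" "0 < b"
  shows "ennpow x (a + b) = ennpow x a * ennpow x b"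
  by (cases x) (auto simp: ennpow_ennreal powr_add ennreal_mult ennreal_top_mult)

lemma measurable_ennpow [measurable]: "(\<lambda>x. ennpow x a) \<in> borel_measurable borel"
  unfolding ennpow_def by measurable

text \<open>The power is an order isomorphism with inverse the power \<open>1 / a\<close>, and a
  lower limit is determined by the values that lie eventually strictly below the terms.\<close>

lemma ennpow_Liminf_le:
  assumes "0 < a"
  shows "ennpow (liminf u) a \<le> liminf (\<lambda>n::nat. ennpow (u n) a)"
  unfolding le_Liminf_iff
proof safe
  fix y assume "y < ennpow (liminf u) a"
  then have "ennpow y (1 / a) < liminf u"
    using ennpow_less_iff[OF assms, of "ennpow y (1 / a)"] assms by (simp add: ennpow_inverse)
  then have "\<forall>\<^sub>F n in sequentially. ennpow y (1 / a) < u n"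
    by (rule less_LiminfD)
  then show "\<forall>\<^sub>F n in sequentially. y < ennpow (u n) a"
    by eventually_elim (use assms ennpow_less_iff[OF assms, of "ennpow y (1 / a)"] in \<open>simp add: ennpow_inverse\<close>)
qed

lemma ennpow_convex:
  assumes "1 \<le> p" "0 \<le> s" "s \<le> 1"
  shows "ennpow (ennreal (1 - s) * x + ennreal s * y) p \<le> ennreal (1 - s) * ennpow x p + ennreal s * ennpow y p"
proof (cases "s = 0 \<or> s = 1")
  case False
  then have s: "0 < s" "s < 1" using assms by auto
  show ?thesis
  proof (cases "x = top \<or> y = top")
    case True
    with s show ?thesis by (auto simp: ennreal_mult_top)
  next
    case False
    then obtain u v where uv: "x = ennreal u" "y = ennreal v" "0 \<le> u" "0 \<le> v"
      by (cases x; cases y) auto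
    have "((1 - s) * u + s * v) powr p \<le> (1 - s) * u powr p + s * v powr p"
    \<comment> \<open>On the boundary the claim reduces to \<open>(1 - s) powr p \<le> 1 - s\<close>
      or to \<open>s powr p \<le> s\<close>, true because \<open>p \<ge> 1\<close>.\<close>
    proof (cases "u = 0 \<or> v = 0")
      case True
      have *: "t powr p \<le> t" if "0 < t" "t < 1" for t :: real
        using powr_mono'[of 1 p t] that assms by simp
      show ?thesis using True *[of s] *[of "1 - s"] s
        by (auto simp: powr_mult uv intro!: mult_right_mono)
    next
      case False
      then show ?thesis using powr_convex[OF assms(1)] uv s
        by (auto simp: convex_on_def)
    qed
    then show ?thesis using s uv
      by (simp add: ennreal_mult[symmetric] ennreal_plus[symmetric] ennpow_ennreal ennreal_leI del: ennreal_plus)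
  qed
qed auto

section \<open>Lebesgue norms: convexity, Hoelder and Minkowski inequalities\<close>

lemma Lp_norm_mono:
  assumes "0 < p" "\<And>x. x \<in> space M \<Longrightarrow> g x \<le> h x"
  shows "Lp_norm M p g \<le> Lp_norm M p h"
  unfolding Lp_norm_def using assms
  by (intro ennpow_mono nn_integral_mono) (auto intro: ennpow_mono)

lemma Lp_norm_le_iff:
  assumes "0 < p"
  shows "Lp_norm M p h \<le> a \<longleftrightarrow> (\<integral>\<^sup>+x. ennpow (h x) p \<partial>M) \<le> ennpow a p"
  unfolding Lp_norm_def
  using ennpow_less_iff[of "1 / p" "ennpow a p" "\<integral>\<^sup>+x. ennpow (h x) p \<partial>M"] assms
  by (auto simp: not_less[symmetric] ennpow_inverse)

lemma Lp_norm_cmult: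
  assumes "0 < p" and [measurable]: "h \<in> borel_measurable M"
  shows "Lp_norm M p (\<lambda>x. c * h x) = c * Lp_norm M p h"
  unfolding Lp_norm_def using assms(1)
  by (simp add: ennpow_mult nn_integral_cmult ennpow_inverse)

text \<open>Balls are convex because the p-th power is a convex function. Minkowski's inequality
  follows from this by scaling, with \<open>p = 1\<close> included.\<close>

lemma Lp_norm_convex:
  assumes "1 \<le> p" "0 \<le> s" "s \<le> 1" and [measurable]: "g \<in> borel_measurable M" "h \<in> borel_measurable M"
    and g: "Lp_norm M p g \<le> a" and h: "Lp_norm M p h \<le> a"
  shows "Lp_norm M p (\<lambda>x. ennreal (1 - s) * g x + ennreal s * h x) \<le> a"
proof -
  have "(\<integral>\<^sup>+x. ennpow (ennreal (1 - s) * g x + ennreal s * h x) p \<partial>M)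
      \<le> (\<integral>\<^sup>+x. ennreal (1 - s) * ennpow (g x) p + ennreal s * ennpow (h x) p \<partial>M)"
    by (intro nn_integral_mono ennpow_convex assms)
  also have "\<dots> = ennreal (1 - s) * (\<integral>\<^sup>+x. ennpow (g x) p \<partial>M) + ennreal s * (\<integral>\<^sup>+x. ennpow (h x) p \<partial>M)"
    by (simp add: nn_integral_add nn_integral_cmult)
  also have "\<dots> \<le> ennreal (1 - s) * ennpow a p + ennreal s * ennpow a p"
    using g h assms(1) by (intro add_mono mult_left_mono) (auto simp: Lp_norm_le_iff)
  also have "\<dots> = ennpow a p"
    using assms(2,3) by (simp add: distrib_right[symmetric] ennreal_plus[symmetric] del: ennreal_plus)
  finally show ?thesis using assms(1) by (simp add: Lp_norm_le_iff)
qed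

lemma Lp_norm_AE_cong:
  assumes "AE x in M. g x = h x" shows "Lp_norm M p g = Lp_norm M p h"
  unfolding Lp_norm_def using assms by (auto intro!: arg_cong[where f="\<lambda>y. ennpow y (1/p)"] nn_integral_cong_AE)

lemma Lp_norm_eq_0_iff:
  assumes "0 < p" and [measurable]: "h \<in> borel_measurable M"
  shows "Lp_norm M p h = 0 \<longleftrightarrow> (AE x in M. h x = 0)"
  unfolding Lp_norm_def using assms(1) by (simp add: ennpow_eq_0_iff nn_integral_0_iff_AE)

lemma ennreal_Young:
  assumes "1 < p"
  shows "x * y \<le> ennreal (1 / p) * ennpow x p + ennreal (1 - 1 / p) * ennpow y (p / (p - 1))"
proof -
  have pos: "0 < 1 - 1 / p" using assms by simp
  show ?thesis
  proof (cases "x = top \<or> y = top")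
    case True
    then have "ennreal (1 / p) * ennpow x p + ennreal (1 - 1 / p) * ennpow y (p / (p - 1)) = top"
      using assms pos by (auto simp: ennreal_mult_top)
    then show ?thesis by (metis top_greatest)
  next
    case False
    then obtain u v where uv: "x = ennreal u" "y = ennreal v" "0 \<le> u" "0 \<le> v"
      by (cases x; cases y) auto
    have "u * v \<le> u powr p / p + v powr (p / (p - 1)) / (p / (p - 1))"
      using assms uv by (intro Youngs_inequality) (auto simp: field_simps)
    also have "v powr (p / (p - 1)) / (p / (p - 1)) = (1 - 1 / p) * v powr (p / (p - 1))"
      using assms by (simp add: field_simps)
    finally show ?thesis using assms uv pos
      by (simp add: ennreal_mult[symmetric] ennreal_plus[symmetric] ennpow_ennreal ennreal_leI del: ennreal_plus)
  qed
qed

lemma Lp_norm_Hoelder: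
  assumes p: "1 < p" and [measurable]: "g \<in> borel_measurable M" "h \<in> borel_measurable M"
  shows "(\<integral>\<^sup>+x. g x * h x \<partial>M) \<le> Lp_norm M p g * Lp_norm M (p / (p - 1)) h"
proof -
  define q where "q = p / (p - 1)"
  have q: "1 < q" using p by (simp add: q_def)
  define a b where "a = Lp_norm M p g" and "b = Lp_norm M q h"
  \<comment> \<open>As \<open>0 * top = 0\<close>, the right-hand side vanishes when one norm is 0,
    even if the other is infinite; then the product must be shown to vanish almost
    everywhere.\<close>
  have 0: "(\<integral>\<^sup>+x. g x * h x \<partial>M) = 0" if "a = 0 \<or> b = 0"
  proof -
    have "AE x in M. g x * h x = 0"
    proof (cases "a = 0")
      case True
      then have "AE x in M. g x = 0" using p by (simp add: a_def Lp_norm_eq_0_iff)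
      then show ?thesis by eventually_elim simp
    next
      case False
      then have "AE x in M. h x = 0" using q that by (simp add: b_def Lp_norm_eq_0_iff)
      then show ?thesis by eventually_elim simp
    qed
    then show ?thesis by (simp add: nn_integral_0_iff_AE)
  qed
  show ?thesis
  proof (cases "a = 0 \<or> b = 0 \<or> a = top \<or> b = top")
    case True
    then consider "a = 0 \<or> b = 0" | "a * b = top"
      by (auto simp: ennreal_mult_eq_top_iff)
    then show ?thesis by cases (use 0 in \<open>auto simp: a_def b_def q_def\<close>)
  next
    case False
    have ab: "a * inverse a = 1" "b * inverse b = 1"
      using False by (auto simp: ennreal_mult_eq_top_iff ennreal_inverse_mult mult.commute less_top[symmetric]
          divide_ennreal_def[symmetric] ennreal_divide_self)
    have g1: "(\<integral>\<^sup>+x. ennpow (inverse a * g x) p \<partial>M) \<le> 1"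
      using Lp_norm_cmult[of p g M "inverse a"] p ab(1) Lp_norm_le_iff[of p M "\<lambda>x. inverse a * g x" 1]
      by (simp add: a_def mult.commute)
    have h1: "(\<integral>\<^sup>+x. ennpow (inverse b * h x) q \<partial>M) \<le> 1"
      using Lp_norm_cmult[of q h M "inverse b"] q ab(2) Lp_norm_le_iff[of q M "\<lambda>x. inverse b * h x" 1]
      by (simp add: b_def mult.commute)
    have "(\<integral>\<^sup>+x. g x * h x \<partial>M) = (\<integral>\<^sup>+x. (a * inverse a) * (b * inverse b) * (g x * h x) \<partial>M)"
      by (simp add: ab)
    also have "\<dots> = (\<integral>\<^sup>+x. (a * b) * ((inverse a * g x) * (inverse b * h x)) \<partial>M)"
      by (intro nn_integral_cong) (simp only: mult_ac)
    also have "\<dots> = a * b * (\<integral>\<^sup>+x. (inverse a * g x) * (inverse b * h x) \<partial>M)"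
      by (simp add: nn_integral_cmult)
    also have "(\<integral>\<^sup>+x. (inverse a * g x) * (inverse b * h x) \<partial>M)
      \<le> (\<integral>\<^sup>+x. ennreal (1 / p) * ennpow (inverse a * g x) p
            + ennreal (1 - 1 / p) * ennpow (inverse b * h x) q \<partial>M)"
      unfolding q_def by (intro nn_integral_mono ennreal_Young p)
    also have "\<dots> = ennreal (1 / p) * (\<integral>\<^sup>+x. ennpow (inverse a * g x) p \<partial>M)
            + ennreal (1 - 1 / p) * (\<integral>\<^sup>+x. ennpow (inverse b * h x) q \<partial>M)"
      by (simp add: nn_integral_add nn_integral_cmult)
    also have "\<dots> \<le> ennreal (1 / p) * 1 + ennreal (1 - 1 / p) * 1"
      using g1 h1 by (intro add_mono mult_left_mono) auto
    also have "\<dots> = 1"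
      using p by (simp add: ennreal_plus[symmetric] del: ennreal_plus)
    finally show ?thesis
      by (simp add: a_def b_def q_def mult_left_mono)
  qed
qed

lemma ennreal_mult_inverse: "a \<noteq> 0 \<Longrightarrow> a \<noteq> top \<Longrightarrow> a * inverse a = (1::ennreal)"
  by (metis divide_ennreal_def ennreal_divide_self less_top)

lemma Lp_norm_triangle:
  assumes p: "1 \<le> p" and [measurable]: "g \<in> borel_measurable M" "h \<in> borel_measurable M"
  shows "Lp_norm M p (\<lambda>x. g x + h x) \<le> Lp_norm M p g + Lp_norm M p h"
proof -
  define a b where "a = Lp_norm M p g" and "b = Lp_norm M p h"
  consider "a = top \<or> b = top" | "a = 0" | "b = 0" | "a \<noteq> 0" "b \<noteq> 0" "a \<noteq> top" "b \<noteq> top" by blast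
  then show ?thesis
  proof cases
    case 1
    then have "a + b = top" by auto
    then show ?thesis unfolding a_def b_def by (metis top_greatest)
  next
    case 2
    then have ae: "AE x in M. g x = 0" using p by (simp add: a_def Lp_norm_eq_0_iff)
    have "Lp_norm M p (\<lambda>x. g x + h x) = Lp_norm M p h"
      by (intro Lp_norm_AE_cong) (use ae in eventually_elim, simp)
    then show ?thesis by simp
  next
    case 3
    then have ae: "AE x in M. h x = 0" using p by (simp add: b_def Lp_norm_eq_0_iff)
    have "Lp_norm M p (\<lambda>x. g x + h x) = Lp_norm M p g"
      by (intro Lp_norm_AE_cong) (use ae in eventually_elim, simp)
    then show ?thesis by simp
  next
    case 4
    then obtain u v where uv: "a = ennreal u" "b = ennreal v" "0 < u" "0 < v"
      by (cases a; cases b) (auto simp: less_le)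
    \<comment> \<open>The weight \<open>b / (a + b)\<close>: with it, \<open>g + h\<close> is
      \<open>a + b\<close> times a convex combination of \<open>g / a\<close> and
      \<open>h / b\<close>, both of norm at most 1.\<close>
    define s where "s = v / (u + v)"
    have s: "0 \<le> s" "s \<le> 1" "1 - s = u / (u + v)" using uv by (auto simp: s_def field_simps)
    have c: "(a + b) * ennreal (1 - s) = a" "(a + b) * ennreal s = b"
      unfolding s(3) using uv by (auto simp: s_def ennreal_plus[symmetric] ennreal_mult[symmetric] simp del: ennreal_plus)
    have i: "a * inverse a = 1" "b * inverse b = 1" using 4 by (auto intro: ennreal_mult_inverse)
    have "Lp_norm M p (\<lambda>x. ennreal (1 - s) * (inverse a * g x) + ennreal s * (inverse b * h x)) \<le> 1"
    proof (intro Lp_norm_convex p s)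
      show "Lp_norm M p (\<lambda>x. inverse a * g x) \<le> 1" "Lp_norm M p (\<lambda>x. inverse b * h x) \<le> 1"
        using p i by (subst Lp_norm_cmult; simp add: a_def[symmetric] b_def[symmetric] mult.commute)+
    qed measurable
    then have "(a + b) * Lp_norm M p (\<lambda>x. ennreal (1 - s) * (inverse a * g x) + ennreal s * (inverse b * h x)) \<le> (a + b) * 1"
      by (rule mult_left_mono) simp
    also have "(a + b) * Lp_norm M p (\<lambda>x. ennreal (1 - s) * (inverse a * g x) + ennreal s * (inverse b * h x))
       = Lp_norm M p (\<lambda>x. (a + b) * (ennreal (1 - s) * (inverse a * g x) + ennreal s * (inverse b * h x)))"
      using p by (simp add: Lp_norm_cmult)
    also have "\<dots> = Lp_norm M p (\<lambda>x. g x + h x)"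
      unfolding distrib_left mult.assoc[symmetric] c i by simp
    finally show ?thesis by (simp add: a_def b_def)
  qed
qed

text \<open>
  The extremal function in Hoelder's inequality. If the norm is 0, then \<open>h\<close> vanishes almost
  everywhere and so does this function, because \<open>0/0 = 0\<close>.
\<close>

definition dual_fun :: "'a measure \<Rightarrow> real \<Rightarrow> ('a \<Rightarrow> ennreal) \<Rightarrow> 'a \<Rightarrow> ennreal" where
  "dual_fun M q h x = ennpow (h x / Lp_norm M q h) (q - 1)"

text \<open>The exponent \<open>q - 1\<close> fits both claims:
  \<open>(q - 1) * (q / (q - 1)) = q\<close> in the conjugate norm, and
  \<open>(q - 1) + 1 = q\<close> in the integral against \<open>h\<close>. Finiteness of the norm
  makes the normalization of \<open>h\<close> possible.\<close>

lemma dual_fun: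
  assumes q: "1 < q" and [measurable]: "h \<in> borel_measurable M" and fin: "Lp_norm M q h < top"
  shows "dual_fun M q h \<in> borel_measurable M"
    and "Lp_norm M (q / (q - 1)) (dual_fun M q h) \<le> 1"
    and "(\<integral>\<^sup>+x. dual_fun M q h x * h x \<partial>M) = Lp_norm M q h"
proof -
  define b where "b = Lp_norm M q h"
  show [measurable]: "dual_fun M q h \<in> borel_measurable M"
    unfolding dual_fun_def by measurable
  have I: "(\<integral>\<^sup>+x. ennpow (h x) q \<partial>M) = ennpow b q"
    using q by (simp add: b_def Lp_norm_def ennpow_inverse)
  have "Lp_norm M (q / (q - 1)) (dual_fun M q h) \<le> 1 \<and> (\<integral>\<^sup>+x. dual_fun M q h x * h x \<partial>M) = b"
  proof (cases "b = 0")
    case True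
    then have ae: "AE x in M. h x = 0" using q by (simp add: b_def Lp_norm_eq_0_iff)
    have "Lp_norm M (q / (q - 1)) (dual_fun M q h) = 0"
      using q ae by (subst Lp_norm_eq_0_iff) (auto simp: dual_fun_def)
    moreover have "(\<integral>\<^sup>+x. dual_fun M q h x * h x \<partial>M) = 0"
      using ae by (subst nn_integral_0_iff_AE) auto
    ultimately show ?thesis by (simp add: True)
  next
    case False
    have bt: "b \<noteq> top" using fin by (simp add: b_def)
    have binv: "b * inverse b = 1"
      using False bt by (metis divide_ennreal_def ennreal_divide_self less_top)
    have pinv: "ennpow (inverse b) r * ennpow b r = 1" if "0 < r" for r
      using that binv by (simp add: ennpow_mult[symmetric] mult.commute)
    have "(\<integral>\<^sup>+x. ennpow (dual_fun M q h x) (q / (q - 1)) \<partial>M) = (\<integral>\<^sup>+x. ennpow (inverse b) q * ennpow (h x) q \<partial>M)"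
      using q by (intro nn_integral_cong)
        (simp add: dual_fun_def ennpow_ennpow b_def divide_ennreal_def ennpow_mult[symmetric] mult.commute)
    also have "\<dots> = 1"
      using q by (simp add: nn_integral_cmult I pinv)
    finally have 1: "Lp_norm M (q / (q - 1)) (dual_fun M q h) \<le> 1"
      using q by (simp add: Lp_norm_def)
    have "(\<integral>\<^sup>+x. dual_fun M q h x * h x \<partial>M) = (\<integral>\<^sup>+x. ennpow (inverse b) (q - 1) * ennpow (h x) q \<partial>M)"
      using q ennpow_add[of "q - 1" 1]
      by (intro nn_integral_cong) (simp add: dual_fun_def b_def divide_ennreal_def ennpow_mult mult_ac)
    also have "\<dots> = ennpow (inverse b) (q - 1) * (ennpow b (q - 1) * b)"
      using q ennpow_add[of "q - 1" 1 b] by (simp add: nn_integral_cmult I)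
    also have "\<dots> = b"
      using q by (simp add: mult.assoc[symmetric] pinv)
    finally show ?thesis using 1 by simp
  qed
  then show "Lp_norm M (q / (q - 1)) (dual_fun M q h) \<le> 1"
    "(\<integral>\<^sup>+x. dual_fun M q h x * h x \<partial>M) = Lp_norm M q h"
    by (auto simp: b_def)
qed

section \<open>Sequence norms and mixed norms\<close>

lemma conj_exponent_cases:
  assumes "1 \<le> q"
  obtains (top) "q = top" "conj_exponent q = 1"
  | (one) "q = 1" "conj_exponent q = top"
  | (real) r where "1 < r" "q = ennreal r" "conj_exponent q = ennreal (r / (r - 1))"
proof (cases "q = top \<or> q = 1")
  case True
  then show ?thesis using top one by (auto simp: conj_exponent_def)
next
  case False
  then obtain r where r: "q = ennreal r" "0 \<le> r" by (cases q) auto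
  then have r1: "1 < r" using assms False by (cases "r = 1") (auto simp: ennreal_1[symmetric] simp del: ennreal_1)
  have "conj_exponent q = ennreal r / (ennreal r - ennreal 1)"
    using False r by (simp add: conj_exponent_def)
  also have "\<dots> = ennreal (r / (r - 1))"
    using r1 by (simp add: ennreal_minus divide_ennreal del: ennreal_1)
  finally show ?thesis using real r r1 by auto
qed

lemma conj_exponent_ge_1: "1 \<le> q \<Longrightarrow> 1 \<le> conj_exponent q"
  by (cases rule: conj_exponent_cases[of q]) (auto simp: ennreal_1[symmetric] simp del: ennreal_1)

lemma lq_norm_top: "lq_norm I top c = (SUP n\<in>I. c n)"
  by (simp add: lq_norm_def)

lemma lq_norm_eq_Lp_norm: "q \<noteq> top \<Longrightarrow> lq_norm I q c = Lp_norm (count_space I) (enn2real q) c"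
  by (simp add: lq_norm_def Lp_norm_def)

lemma lq_norm_ennreal: "0 \<le> r \<Longrightarrow> lq_norm I (ennreal r) c = Lp_norm (count_space I) r c"
  by (simp add: lq_norm_eq_Lp_norm)

lemma lq_norm_1: "lq_norm I 1 c = (\<integral>\<^sup>+n. c n \<partial>count_space I)"
  by (simp add: lq_norm_def)

lemma enn2real_ge_1: "1 \<le> q \<Longrightarrow> q \<noteq> top \<Longrightarrow> 1 \<le> enn2real q"
  by (cases q) (auto simp: ennreal_1[symmetric] simp del: ennreal_1)

lemma borel_measurable_nn_integral_count_space:
  fixes g :: "'i \<Rightarrow> 'a \<Rightarrow> ennreal"
  assumes "countable I" and [measurable]: "\<And>n. n \<in> I \<Longrightarrow> g n \<in> borel_measurable M"
  shows "(\<lambda>x. \<integral>\<^sup>+n. g n x \<partial>count_space I) \<in> borel_measurable M"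
proof (cases "finite I")
  case True
  then show ?thesis by (simp add: nn_integral_count_space_finite)
next
  case False
  then have "I \<noteq> {}" by auto
  note * = bij_betw_from_nat_into[OF \<open>countable I\<close> False]
  have [measurable]: "g (from_nat_into I i) \<in> borel_measurable M" for i
    using \<open>I \<noteq> {}\<close> by (intro assms from_nat_into)
  show ?thesis
    by (simp add: nn_integral_bij_count_space[symmetric, OF *] nn_integral_count_space_nat)
qed

lemma borel_measurable_lq_norm:
  assumes "countable I" and [measurable]: "\<And>n. n \<in> I \<Longrightarrow> g n \<in> borel_measurable M"
  shows "(\<lambda>x. lq_norm I q (\<lambda>n. g n x)) \<in> borel_measurable M"
proof (cases "q = top")
  case True
  then show ?thesis using assms by (simp add: lq_norm_top)
next
  case False
  have [measurable]: "(\<lambda>x. \<integral>\<^sup>+n. ennpow (g n x) (enn2real q) \<partial>count_space I) \<in> borel_measurable M"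
    by (intro borel_measurable_nn_integral_count_space assms(1)) measurable
  show ?thesis using False by (simp add: lq_norm_def)
qed

lemma lq_norm_mono:
  assumes "1 \<le> q" "\<And>n. n \<in> I \<Longrightarrow> c n \<le> d n"
  shows "lq_norm I q c \<le> lq_norm I q d"
proof (cases "q = top")
  case True
  then show ?thesis using assms by (auto simp: lq_norm_top intro!: SUP_mono)
next
  case False
  then show ?thesis using assms enn2real_ge_1[of q]
    by (auto simp: lq_norm_eq_Lp_norm intro!: Lp_norm_mono)
qed

lemma lq_norm_cmult:
  assumes "1 \<le> q"
  shows "lq_norm I q (\<lambda>n. a * c n) = a * lq_norm I q c"
proof (cases "q = top")
  case True
  then show ?thesis by (simp add: lq_norm_top SUP_mult_left_ennreal)
next
  case False
  then show ?thesis using enn2real_ge_1[OF assms False] by (simp add: lq_norm_eq_Lp_norm Lp_norm_cmult)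
qed

lemma lq_norm_triangle:
  assumes "1 \<le> q"
  shows "lq_norm I q (\<lambda>n. c n + d n) \<le> lq_norm I q c + lq_norm I q d"
proof (cases "q = top")
  case True
  then show ?thesis by (auto simp: lq_norm_top intro!: SUP_least add_mono SUP_upper)
next
  case False
  then show ?thesis using enn2real_ge_1[OF assms False] by (simp add: lq_norm_eq_Lp_norm Lp_norm_triangle)
qed

lemma lq_norm_Hoelder:
  assumes "1 \<le> q"
  shows "(\<integral>\<^sup>+n. c n * d n \<partial>count_space I) \<le> lq_norm I q c * lq_norm I (conj_exponent q) d"
proof -
  have *: "(\<integral>\<^sup>+n. c n * d n \<partial>count_space I) \<le> (SUP n\<in>I. c n) * (\<integral>\<^sup>+n. d n \<partial>count_space I)" for c d :: "int \<Rightarrow> ennreal"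
    by (subst nn_integral_cmult[symmetric]) (auto intro!: nn_integral_mono mult_right_mono SUP_upper)
  show ?thesis using assms
  proof (cases rule: conj_exponent_cases)
    case top
    then show ?thesis using * by (simp add: lq_norm_top lq_norm_1)
  next
    case one
    then show ?thesis using *[of d c] by (simp add: lq_norm_top lq_norm_1 mult.commute)
  next
    case (real r)
    then show ?thesis using Lp_norm_Hoelder[of r c "count_space I" d] by (simp add: lq_norm_ennreal)
  qed
qed

text \<open>The extremal sequence must depend measurably on \<open>x\<close>. For
  \<open>q = top\<close> it is constantly 1, for finite \<open>q > 1\<close> it is
  \<open>dual_fun\<close> for the counting measure, and for \<open>q = 1\<close> it is the indicator
  of one index attaining the supremum. Finite support makes the supremum attained and the norms
  finite.\<close>

lemma lq_norm_dual:
  fixes g :: "int \<Rightarrow> 'a \<Rightarrow> ennreal"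
  assumes q: "1 \<le> q" and J: "finite J" "J \<subseteq> I" and I: "countable I"
    and g: "\<And>n. n \<in> I \<Longrightarrow> g n \<in> borel_measurable M"
    and supp: "\<And>n x. n \<notin> J \<Longrightarrow> g n x = 0" and fin: "\<And>n x. g n x < top"
  obtains h where "\<And>n. n \<in> I \<Longrightarrow> h n \<in> borel_measurable M"
    "\<And>x. lq_norm I q (\<lambda>n. h n x) \<le> 1"
    "\<And>x. (\<integral>\<^sup>+n. h n x * g n x \<partial>count_space I) = lq_norm I (conj_exponent q) (\<lambda>n. g n x)"
  using q
proof (cases rule: conj_exponent_cases)
  case top
  show ?thesis
    by (rule that[of "\<lambda>_ _. 1"]) (simp_all add: top(2) lq_norm_1, simp add: top(1) lq_norm_top SUP_least)
next
  case one
  define S where "S x = (SUP n\<in>I. g n x)" for x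
  have [measurable]: "S \<in> borel_measurable M" unfolding S_def by (intro borel_measurable_SUP I g)
  \<comment> \<open>\<open>A n x\<close>: the supremum over the finite set \<open>J\<close> is first attained at \<open>n\<close>.\<close>
  define A where "A n x \<longleftrightarrow> n \<in> J \<and> g n x = S x \<and> (\<forall>m\<in>J. m < n \<longrightarrow> g m x \<noteq> S x)" for n x
  have gJ: "g n \<in> borel_measurable M" if "n \<in> J" for n using that J g by auto
  show ?thesis
  proof (rule that[of "\<lambda>n x. if A n x then 1 else 0"])
    show "(\<lambda>x. if A n x then 1 else 0) \<in> borel_measurable M" for n
    proof (cases "n \<in> J")
      case True
      have "Measurable.pred M (\<lambda>x. n \<in> J \<and> g n x = S x \<and> (\<forall>m\<in>J. m < n \<longrightarrow> g m x \<noteq> S x))"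
        using J gJ True by (intro pred_intros_logic pred_intros_finite) auto
      then have [measurable]: "Measurable.pred M (A n)" by (simp add: A_def[abs_def])
      show ?thesis by measurable
    qed (simp add: A_def)
  next
    fix x
    have uniq: "m = n" if "A m x" "A n x" for m n
      using that by (auto simp: A_def) (meson linorder_neqE)
    have sub: "(\<integral>\<^sup>+n. (if A n x then 1 else 0) * c n \<partial>count_space I) = c m" if "A m x" for c m
    proof -
      have mI: "m \<in> I" using that J by (auto simp: A_def)
      have "(\<integral>\<^sup>+n. (if A n x then 1 else 0) * c n \<partial>count_space I) = (\<integral>\<^sup>+n. c m * indicator {m} n \<partial>count_space I)"
        using uniq that by (intro nn_integral_cong) (auto simp: indicator_def)
      also have "\<dots> = c m" using mI by (simp add: nn_integral_cmult_indicator)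
      finally show ?thesis .
    qed
    have "(\<integral>\<^sup>+n. (if A n x then 1 else 0) \<partial>count_space I) \<le> 1 \<and>
      (\<integral>\<^sup>+n. (if A n x then 1 else 0) * g n x \<partial>count_space I) = S x"
    proof (cases "\<exists>m. A m x")
      case True
      then obtain m where m: "A m x" by auto
      show ?thesis using sub[OF m, of "\<lambda>_. 1"] sub[OF m, of "\<lambda>n. g n x"] m by (simp add: A_def)
    next
      case False
      \<comment> \<open>A nonzero supremum is a maximum over the finite set \<open>J\<close>, and
        the least maximizing index would satisfy \<open>A\<close>.\<close>
      have "S x = 0"
      proof (rule ccontr)
        assume S0: "S x \<noteq> 0"
        have "S x = (SUP n\<in>J. g n x)"
          unfolding S_def
        proof (rule antisym)
          show "(SUP n\<in>I. g n x) \<le> (SUP n\<in>J. g n x)"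
          proof (rule SUP_least)
            fix n show "g n x \<le> (SUP n\<in>J. g n x)"
              by (cases "n \<in> J") (auto simp: supp intro: SUP_upper)
          qed
        qed (use J in \<open>auto intro: SUP_subset_mono\<close>)
        moreover have ne: "J \<noteq> {}" using S0 calculation by (auto simp: bot_ennreal)
        ultimately have "S x = Max ((\<lambda>n. g n x) ` J)"
          using J by (simp add: Max_Sup)
        then have "S x \<in> (\<lambda>n. g n x) ` J"
          using J ne by (metis Max_in finite_imageI image_is_empty)
        then have ex: "{n\<in>J. g n x = S x} \<noteq> {}" by auto
        have fin: "finite {n\<in>J. g n x = S x}" using J by auto
        have "A (Min {n\<in>J. g n x = S x}) x"
          using Min_in[OF fin ex] Min_le[OF fin] by (force simp: A_def)
        then show False using False by auto
      qed
      then show ?thesis using False by simp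
    qed
    then show "lq_norm I q (\<lambda>n. if A n x then 1 else 0) \<le> 1"
      "(\<integral>\<^sup>+n. (if A n x then 1 else 0) * g n x \<partial>count_space I) = lq_norm I (conj_exponent q) (\<lambda>n. g n x)"
      unfolding one(2) by (simp_all add: one(1) lq_norm_1 lq_norm_top S_def)
  qed
next
  case (real r)
  define s where "s = r / (r - 1)"
  have s: "1 < s" "s / (s - 1) = r" using real(1) by (auto simp: s_def field_simps)
  have eq: "lq_norm I q c = Lp_norm (count_space I) (s / (s - 1)) c"
    "lq_norm I (conj_exponent q) c = Lp_norm (count_space I) s c" for c
    unfolding real(3) s(2) unfolding real(2) s_def using real(1) by (simp_all add: lq_norm_ennreal)
  have fn: "Lp_norm (count_space I) s (\<lambda>n. g n x) < top" for x
  proof -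
    have "(\<integral>\<^sup>+n. ennpow (g n x) s \<partial>count_space I) = (\<Sum>n\<in>J. ennpow (g n x) s)"
      using J by (intro nn_integral_count_space'[OF J(1)]) (auto simp: supp)
    also have "\<dots> < top" using fin by (auto simp: less_top[symmetric] ennpow_eq_top_iff J)
    finally show ?thesis by (simp add: Lp_norm_def less_top[symmetric] ennpow_eq_top_iff)
  qed
  have m: "(\<lambda>x. Lp_norm (count_space I) s (\<lambda>n. g n x)) \<in> borel_measurable M"
    unfolding eq(2)[symmetric] by (intro borel_measurable_lq_norm I g)
  show ?thesis
  proof (rule that[of "\<lambda>n x. dual_fun (count_space I) s (\<lambda>n. g n x) n"])
    show "(\<lambda>x. dual_fun (count_space I) s (\<lambda>n. g n x) n) \<in> borel_measurable M" if "n \<in> I" for n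
      unfolding dual_fun_def using g[OF that] m by measurable
    show "lq_norm I q (\<lambda>n. dual_fun (count_space I) s (\<lambda>n. g n x) n) \<le> 1" for x
      unfolding eq by (intro dual_fun s fn) auto
    show "(\<integral>\<^sup>+n. dual_fun (count_space I) s (\<lambda>n. g n x) n * g n x \<partial>count_space I) = lq_norm I (conj_exponent q) (\<lambda>n. g n x)" for x
      unfolding eq by (intro dual_fun s fn) auto
  qed
qed

lemma lq_norm_Fatou:
  assumes q: "1 \<le> q" and le: "\<And>n. n \<in> I \<Longrightarrow> c n \<le> liminf (\<lambda>j. d j n)"
  shows "lq_norm I q c \<le> liminf (\<lambda>j. lq_norm I q (d j))"
proof (cases "q = top")
  case True
  have "c n \<le> liminf (\<lambda>j. SUP n\<in>I. d j n)" if "n \<in> I" for n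
    using le[OF that] by (rule order_trans) (auto intro!: Liminf_mono always_eventually SUP_upper that)
  then show ?thesis by (auto simp: True lq_norm_top intro: SUP_least)
next
  case False
  note r = enn2real_ge_1[OF q False]
  have "lq_norm I q c \<le> lq_norm I q (\<lambda>n. liminf (\<lambda>j. d j n))"
    by (intro lq_norm_mono q le)
  also have "\<dots> = ennpow (\<integral>\<^sup>+n. ennpow (liminf (\<lambda>j. d j n)) (enn2real q) \<partial>count_space I) (1 / enn2real q)"
    using False by (simp add: lq_norm_def)
  also have "\<dots> \<le> ennpow (\<integral>\<^sup>+n. liminf (\<lambda>j. ennpow (d j n) (enn2real q)) \<partial>count_space I) (1 / enn2real q)"
    using r by (intro ennpow_mono nn_integral_mono ennpow_Liminf_le) auto
  also have "\<dots> \<le> ennpow (liminf (\<lambda>j. \<integral>\<^sup>+n. ennpow (d j n) (enn2real q) \<partial>count_space I)) (1 / enn2real q)"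
    using r by (intro ennpow_mono nn_integral_liminf) auto
  also have "\<dots> \<le> liminf (\<lambda>j. ennpow (\<integral>\<^sup>+n. ennpow (d j n) (enn2real q) \<partial>count_space I) (1 / enn2real q))"
    using r by (intro ennpow_Liminf_le) auto
  finally show ?thesis using False by (simp add: lq_norm_def)
qed

section \<open>Mixed norms: Hoelder, Minkowski, Fatou and duality\<close>

lemma borel_measurable_mixed_inner:
  fixes g :: "int \<Rightarrow> 'a::metric_space \<Rightarrow> ennreal"
  assumes "\<And>n. n \<in> scales TYPE('a) \<Longrightarrow> g n \<in> borel_measurable M"
  shows "(\<lambda>x. lq_norm (scales TYPE('a)) q (\<lambda>n. g n x)) \<in> borel_measurable M"
  using assms by (intro borel_measurable_lq_norm) auto

lemma mixed_norm_Hoelder: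
  fixes f :: "int \<Rightarrow> 'a::metric_space \<Rightarrow> ennreal"
  assumes p: "1 < p" and q: "1 \<le> q"
    and f: "\<And>n. n \<in> scales TYPE('a) \<Longrightarrow> f n \<in> borel_measurable M"
    and g: "\<And>n. n \<in> scales TYPE('a) \<Longrightarrow> g n \<in> borel_measurable M"
  shows "(\<integral>\<^sup>+x. \<integral>\<^sup>+n. f n x * g n x \<partial>count_space (scales TYPE('a)) \<partial>M)
    \<le> mixed_norm M p q f * mixed_norm M (p / (p - 1)) (conj_exponent q) g"
  unfolding mixed_norm_def
  by (rule order_trans[OF nn_integral_mono[OF lq_norm_Hoelder[OF q]]])
    (intro Lp_norm_Hoelder p borel_measurable_mixed_inner f g)

lemma mixed_norm_cmult:
  fixes f :: "int \<Rightarrow> 'a::metric_space \<Rightarrow> ennreal"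
  assumes p: "0 < p" and q: "1 \<le> q"
    and f: "\<And>n. n \<in> scales TYPE('a) \<Longrightarrow> f n \<in> borel_measurable M"
  shows "mixed_norm M p q (\<lambda>n x. a * f n x) = a * mixed_norm M p q f"
  unfolding mixed_norm_def lq_norm_cmult[OF q]
  by (intro Lp_norm_cmult p borel_measurable_mixed_inner f)

lemma mixed_norm_triangle:
  fixes f :: "int \<Rightarrow> 'a::metric_space \<Rightarrow> ennreal"
  assumes p: "1 \<le> p" and q: "1 \<le> q"
    and f: "\<And>n. n \<in> scales TYPE('a) \<Longrightarrow> f n \<in> borel_measurable M"
    and g: "\<And>n. n \<in> scales TYPE('a) \<Longrightarrow> g n \<in> borel_measurable M"
  shows "mixed_norm M p q (\<lambda>n x. f n x + g n x) \<le> mixed_norm M p q f + mixed_norm M p q g"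
proof -
  have "mixed_norm M p q (\<lambda>n x. f n x + g n x)
     \<le> Lp_norm M p (\<lambda>x. lq_norm (scales TYPE('a)) q (\<lambda>n. f n x) + lq_norm (scales TYPE('a)) q (\<lambda>n. g n x))"
    unfolding mixed_norm_def using p by (intro Lp_norm_mono lq_norm_triangle q) auto
  also have "\<dots> \<le> mixed_norm M p q f + mixed_norm M p q g"
    unfolding mixed_norm_def by (intro Lp_norm_triangle p borel_measurable_mixed_inner f g)
  finally show ?thesis .
qed

text \<open>One-sided by design: a weak limit of measures controls the entries of the dual potential
  only through lower limits. Fatou's lemma is applied once in the scales and once in the space
  variable.\<close>

lemma mixed_norm_Fatou:
  fixes g :: "nat \<Rightarrow> int \<Rightarrow> 'a::metric_space \<Rightarrow> ennreal"
  assumes p: "0 < p" and q: "1 \<le> q"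
    and g: "\<And>j n. n \<in> scales TYPE('a) \<Longrightarrow> g j n \<in> borel_measurable M"
    and le: "\<And>n x. n \<in> scales TYPE('a) \<Longrightarrow> h n x \<le> liminf (\<lambda>j. g j n x)"
    and bd: "\<And>j. mixed_norm M p q (g j) \<le> a"
  shows "mixed_norm M p q h \<le> a"
proof -
  let ?N = "\<lambda>j x. lq_norm (scales TYPE('a)) q (\<lambda>n. g j n x)"
  have [measurable]: "?N j \<in> borel_measurable M" for j
    by (intro borel_measurable_mixed_inner g)
  have "(\<integral>\<^sup>+x. ennpow (lq_norm (scales TYPE('a)) q (\<lambda>n. h n x)) p \<partial>M)
     \<le> (\<integral>\<^sup>+x. ennpow (liminf (\<lambda>j. ?N j x)) p \<partial>M)"
    using p by (intro nn_integral_mono ennpow_mono lq_norm_Fatou q le) auto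
  also have "\<dots> \<le> (\<integral>\<^sup>+x. liminf (\<lambda>j. ennpow (?N j x) p) \<partial>M)"
    by (intro nn_integral_mono ennpow_Liminf_le p)
  also have "\<dots> \<le> liminf (\<lambda>j. \<integral>\<^sup>+x. ennpow (?N j x) p \<partial>M)"
    by (intro nn_integral_liminf) measurable
  also have "\<dots> \<le> liminf (\<lambda>j. ennpow a p)"
    using bd p by (intro Liminf_mono always_eventually) (auto simp: mixed_norm_def Lp_norm_le_iff)
  also have "\<dots> = ennpow a p" by (simp add: Liminf_const)
  finally show ?thesis using p by (simp add: mixed_norm_def Lp_norm_le_iff)
qed

text \<open>The extremal test sequence is a product: \<open>h\<close> is extremal over the scales at
  each point, and \<open>u\<close> is extremal for the resulting function \<open>G\<close> of the
  point. Its norm is at most that of \<open>u\<close>, hence at most 1, and its pairing with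
  \<open>g\<close> is the norm to be bounded.\<close>

lemma mixed_norm_le_dual:
  fixes g :: "int \<Rightarrow> 'a::metric_space \<Rightarrow> ennreal"
  assumes p: "1 < p" and q: "1 \<le> q" and J: "finite J" "J \<subseteq> scales TYPE('a)"
    and g: "\<And>n. n \<in> scales TYPE('a) \<Longrightarrow> g n \<in> borel_measurable M"
    and supp: "\<And>n x. n \<notin> J \<Longrightarrow> g n x = 0" and fin: "\<And>n x. g n x < top"
    and fin_norm: "mixed_norm M (p / (p - 1)) (conj_exponent q) g < top"
    and bd: "\<And>f. (\<And>n. n \<in> scales TYPE('a) \<Longrightarrow> f n \<in> borel_measurable M) \<Longrightarrow> mixed_norm M p q f \<le> 1 \<Longrightarrow>
       (\<integral>\<^sup>+x. \<integral>\<^sup>+n. f n x * g n x \<partial>count_space (scales TYPE('a)) \<partial>M) \<le> a"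
  shows "mixed_norm M (p / (p - 1)) (conj_exponent q) g \<le> a"
proof -
  let ?I = "scales TYPE('a)"
  obtain h where h: "\<And>n. n \<in> ?I \<Longrightarrow> h n \<in> borel_measurable M"
    "\<And>x. lq_norm ?I q (\<lambda>n. h n x) \<le> 1"
    "\<And>x. (\<integral>\<^sup>+n. h n x * g n x \<partial>count_space ?I) = lq_norm ?I (conj_exponent q) (\<lambda>n. g n x)"
    by (rule lq_norm_dual[OF q J countableI_type, where g = g and M = M]) (auto intro: g supp fin)
  define G where "G x = lq_norm ?I (conj_exponent q) (\<lambda>n. g n x)" for x
  have [measurable]: "G \<in> borel_measurable M"
    unfolding G_def by (intro borel_measurable_mixed_inner g)
  define r where "r = p / (p - 1)"
  have r: "1 < r" "r / (r - 1) = p" using p by (auto simp: r_def field_simps)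
  have eq: "mixed_norm M (p / (p - 1)) (conj_exponent q) g = Lp_norm M r G"
    by (simp add: mixed_norm_def r_def G_def[abs_def])
  define u where "u = dual_fun M r G"
  note u = dual_fun[OF r(1) \<open>G \<in> borel_measurable M\<close> fin_norm[unfolded eq], folded u_def, unfolded r(2)]
  have um [measurable]: "u \<in> borel_measurable M" by (rule u)
  have "mixed_norm M p q (\<lambda>n x. u x * h n x) \<le> Lp_norm M p u"
    unfolding mixed_norm_def lq_norm_cmult[OF q]
    using p mult_left_mono[OF h(2)] by (intro Lp_norm_mono) auto
  then have "(\<integral>\<^sup>+x. \<integral>\<^sup>+n. (u x * h n x) * g n x \<partial>count_space ?I \<partial>M) \<le> a"
    using u(2) h(1) by (intro bd) auto
  also have "(\<integral>\<^sup>+x. \<integral>\<^sup>+n. (u x * h n x) * g n x \<partial>count_space ?I \<partial>M) = (\<integral>\<^sup>+x. u x * G x \<partial>M)"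
    by (simp add: mult.assoc nn_integral_cmult h(3) G_def)
  finally show ?thesis by (simp add: u eq)
qed

section \<open>Duality for finitely many kernels\<close>

text \<open>The image of \<open>S\<close> in the plane is convex and misses the open positive
  quadrant. A separating line has a normal with nonnegative entries, which are normalized to
  \<open>1 - l\<close> and \<open>l\<close>.\<close>

lemma two_function_alternative:
  fixes S :: "('i \<Rightarrow> real) set"
  assumes conv: "\<And>v w s. v \<in> S \<Longrightarrow> w \<in> S \<Longrightarrow> 0 \<le> s \<Longrightarrow> s \<le> 1 \<Longrightarrow> (\<lambda>i. (1 - s) * v i + s * w i) \<in> S"
    and no: "\<And>v. v \<in> S \<Longrightarrow> \<not> (0 < v i \<and> 0 < v j)"
  obtains l where "0 \<le> l" "l \<le> 1" "\<And>v. v \<in> S \<Longrightarrow> (1 - l) * v i + l * v j \<le> 0"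
proof (cases "S = {}")
  case True
  then show ?thesis using that[of 0] by simp
next
  case False
  define A where "A = (\<lambda>v. (v i, v j)) ` S"
  define Q :: "(real \<times> real) set" where "Q = {0<..} \<times> {0<..}"
  have "convex A"
    unfolding convex_alt
  proof (intro ballI allI impI)
    fix x y and u :: real assume "x \<in> A" "y \<in> A" and u: "0 \<le> u \<and> u \<le> 1"
    then obtain v w where vw: "v \<in> S" "w \<in> S" "x = (v i, v j)" "y = (w i, w j)" by (auto simp: A_def)
    show "(1 - u) *\<^sub>R x + u *\<^sub>R y \<in> A"
      unfolding A_def by (rule image_eqI[OF _ conv[OF vw(1,2)]]) (use u vw in auto)
  qed
  moreover have "convex Q" unfolding Q_def by (intro convex_Times convex_real_interval)
  moreover have "Q \<noteq> {}" by (auto simp: Q_def intro!: exI[of _ 1])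
  moreover have "A \<noteq> {}" using False by (simp add: A_def)
  moreover have "A \<inter> Q = {}" using no by (auto simp: A_def Q_def)
  ultimately obtain a b where ab: "a \<noteq> 0" "\<forall>x\<in>A. inner a x \<le> b" "\<forall>x\<in>Q. b \<le> inner a x"
    using separating_hyperplane_sets[of A Q] by blast
  obtain c d where a: "a = (c, d)" by (cases a)
  have Q: "b \<le> c * x + d * y" if "0 < x" "0 < y" for x y
    using ab(3) that by (auto simp: Q_def a)
  \<comment> \<open>The quadrant comes arbitrarily close to the origin. As \<open>w\<close> is
    positive and bounds \<open>c + d\<close>, the diagonal point with entries
    \<open>b / w / 2\<close> has inner product at most \<open>b / 2\<close>.\<close>
  have b: "b \<le> 0"
  proof (rule ccontr)
    assume "\<not> b \<le> 0"
    define w where "w = 1 + \<bar>c\<bar> + \<bar>d\<bar>"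
    have w: "0 < w" "c + d \<le> w" by (auto simp: w_def)
    have e: "0 < b / w / 2" using w \<open>\<not> b \<le> 0\<close> by simp
    have "b \<le> b / w / 2 * (c + d)" using Q[OF e e] unfolding distrib_left mult.commute[of "b / w / 2"] .
    also have "\<dots> \<le> b / w / 2 * w"
      using e w by (intro mult_left_mono) auto
    also have "\<dots> = b / 2" using w by simp
    finally show False using \<open>\<not> b \<le> 0\<close> by simp
  qed
  \<comment> \<open>A negative entry of the normal would make the inner product unbounded below
    along a ray in the quadrant.\<close>
  have cd: "0 \<le> c" "0 \<le> d"
  proof -
    have False if e: "e < 0" and le: "\<And>x. 0 < x \<Longrightarrow> b \<le> e * x + f" for e f :: real
    proof -
      define y where "y = (\<bar>b\<bar> + \<bar>f\<bar> + 1) / (- e)"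
      have "0 < y" using e unfolding y_def by (intro divide_pos_pos) auto
      moreover have "e * y = - (\<bar>b\<bar> + \<bar>f\<bar> + 1)" using e by (simp add: y_def)
      ultimately show False using le[of y] by linarith
    qed
    from this[of c d] this[of d c] show "0 \<le> c" "0 \<le> d"
      using Q[of _ 1] Q[of 1] by (force simp: not_less[symmetric] add.commute)+
  qed
  have pos: "0 < c + d" using cd ab(1) a by (auto simp: zero_prod_def less_le)
  show ?thesis
  proof (rule that[of "d / (c + d)"])
    show "0 \<le> d / (c + d)" "d / (c + d) \<le> 1" using cd pos by auto
    fix v assume "v \<in> S"
    then have "c * v i + d * v j \<le> 0" using ab(2) b by (force simp: A_def a)
    moreover have "(1 - d / (c + d)) * v i + d / (c + d) * v j = (c * v i + d * v j) / (c + d)"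
    proof -
      have "1 - d / (c + d) = c / (c + d)" using pos by (simp add: field_simps)
      then show ?thesis by (simp add: add_divide_distrib)
    qed
    ultimately show "(1 - d / (c + d)) * v i + d / (c + d) * v j \<le> 0"
      using pos by (simp add: divide_nonpos_pos)
  qed
qed

text \<open>Separation takes place only in the plane: by induction, two coordinates are merged into
  a convex combination with the weight from \<open>two_function_alternative\<close>, and the weight
  of the merged coordinate is later divided between them. This is the minimax principle with
  finitely many pure strategies on one side.\<close>

lemma finite_alternative:
  fixes S :: "('i \<Rightarrow> real) set"
  assumes "finite F" "F \<noteq> {}"
    and "\<And>v w s. v \<in> S \<Longrightarrow> w \<in> S \<Longrightarrow> 0 \<le> s \<Longrightarrow> s \<le> 1 \<Longrightarrow> (\<lambda>i. (1 - s) * v i + s * w i) \<in> S"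
    and "\<And>v. v \<in> S \<Longrightarrow> \<exists>i\<in>F. v i \<le> 0"
  shows "\<exists>a. (\<forall>i\<in>F. 0 \<le> a i) \<and> sum a F = 1 \<and> (\<forall>v\<in>S. (\<Sum>i\<in>F. a i * v i) \<le> 0)"
  using assms
proof (induction F arbitrary: S rule: finite_ne_induct)
  case (singleton i)
  then show ?case by (intro exI[of _ "\<lambda>_. 1"]) auto
next
  case (insert j F)
  obtain i where i: "i \<in> F" using insert.hyps by auto
  have ij: "i \<noteq> j" using i insert.hyps by auto
  \<comment> \<open>On \<open>C\<close> the other coordinates are positive, so \<open>v i\<close>
    and \<open>v j\<close> cannot both be positive. Off \<open>C\<close> some coordinate in
    \<open>F - {i}\<close> is already nonpositive, and merging does not change it.\<close>
  define C where "C = {v \<in> S. \<forall>k\<in>F - {i}. 0 < v k}"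
  have pos_comb: "0 < (1 - s) * x + s * y" if "0 \<le> s" "s \<le> 1" "0 < x" "0 < y" for s x y :: real
    using that by (cases "s = 0"; cases "s = 1") (auto intro!: add_pos_pos mult_pos_pos)
  have "\<And>v w s. v \<in> C \<Longrightarrow> w \<in> C \<Longrightarrow> 0 \<le> s \<Longrightarrow> s \<le> 1 \<Longrightarrow> (\<lambda>i. (1 - s) * v i + s * w i) \<in> C"
    unfolding C_def using insert.prems(1) pos_comb by auto
  moreover have "\<not> (0 < v i \<and> 0 < v j)" if "v \<in> C" for v
    using that insert.prems(2)[of v] by (force simp: C_def)
  ultimately obtain l where l: "0 \<le> l" "l \<le> 1" "\<And>v. v \<in> C \<Longrightarrow> (1 - l) * v i + l * v j \<le> 0"
    using two_function_alternative[of C i j] by blast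
  \<comment> \<open>The coordinates \<open>i\<close> and \<open>j\<close> are merged into the single coordinate \<open>i\<close>.\<close>
  define T where "T v = v(i := (1 - l) * v i + l * v j)" for v :: "'i \<Rightarrow> real"
  have "\<exists>a. (\<forall>i\<in>F. 0 \<le> a i) \<and> sum a F = 1 \<and> (\<forall>v\<in>T ` S. (\<Sum>i\<in>F. a i * v i) \<le> 0)"
  proof (rule insert.IH)
    fix v w and s :: real assume "v \<in> T ` S" "w \<in> T ` S" and s: "0 \<le> s" "s \<le> 1"
    then obtain v' w' where vw: "v' \<in> S" "w' \<in> S" "v = T v'" "w = T w'" by auto
    have "(\<lambda>i. (1 - s) * v i + s * w i) = T (\<lambda>i. (1 - s) * v' i + s * w' i)"
      by (auto simp: vw T_def algebra_simps)
    then show "(\<lambda>i. (1 - s) * v i + s * w i) \<in> T ` S"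
      using insert.prems(1)[OF vw(1,2) s] by auto
  next
    fix v assume "v \<in> T ` S"
    then obtain v' where v': "v' \<in> S" "v = T v'" by auto
    show "\<exists>k\<in>F. v k \<le> 0"
    proof (cases "v' \<in> C")
      case True
      then show ?thesis using l(3) i v' by (auto simp: T_def)
    next
      case False
      then obtain k where "k \<in> F" "k \<noteq> i" "v' k \<le> 0" using v' by (force simp: C_def)
      then show ?thesis using v' by (auto simp: T_def intro!: bexI[of _ k])
    qed
  qed
  then obtain a where a: "\<forall>i\<in>F. 0 \<le> a i" "sum a F = 1" "\<And>v. v \<in> S \<Longrightarrow> (\<Sum>k\<in>F. a k * T v k) \<le> 0"
    by auto
  define b where "b = a(i := (1 - l) * a i, j := l * a i)"
  have split: "(\<Sum>k\<in>insert j F. b k * v k) = (\<Sum>k\<in>F. a k * T v k)" for v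
  proof -
    have "(\<Sum>k\<in>F - {i}. b k * v k) = (\<Sum>k\<in>F - {i}. a k * T v k)"
      using insert.hyps by (intro sum.cong) (auto simp: b_def T_def)
    then show ?thesis using insert.hyps i ij
      by (simp add: sum.remove[of F i]) (simp add: b_def T_def algebra_simps)
  qed
  show ?case
  proof (intro exI[of _ b] conjI ballI)
    show "0 \<le> b k" if "k \<in> insert j F" for k using that a i l by (auto simp: b_def)
    have "T (\<lambda>_. 1) = (\<lambda>_. 1)" by (auto simp: T_def)
    then show "sum b (insert j F) = 1" using split[of "\<lambda>_. 1"] a by simp
    show "(\<Sum>k\<in>insert j F. b k * v k) \<le> 0" if "v \<in> S" for v
      using a(3)[OF that] by (simp add: split)
  qed
qed

text \<open>Finiteness of this norm allows pairings with a kernel to be treated as real numbers and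
  \<open>dual_fun\<close> to be used.\<close>

lemma mixed_norm_finite:
  fixes g :: "int \<Rightarrow> 'a::metric_space \<Rightarrow> ennreal"
  assumes p: "0 < p" and q: "1 \<le> q" and J: "finite J" and [measurable]: "A \<in> sets M" and A: "emeasure M A < top"
    and g: "\<And>n x. g n x \<le> ennreal c * indicator J n * indicator A x"
  shows "mixed_norm M p q g < top"
proof -
  let ?I = "scales TYPE('a)"
  have fin: "lq_norm ?I q (indicator J) < top"
  proof (cases "q = top")
    case True
    have "(SUP n\<in>?I. indicator J n) \<le> (1 :: ennreal)"
      by (rule SUP_least) (auto simp: indicator_def)
    then show ?thesis by (simp add: True lq_norm_top order_le_less_trans)
  next
    case False
    have "(\<integral>\<^sup>+n. ennpow (indicator J n) (enn2real q) \<partial>count_space ?I) = (\<integral>\<^sup>+n. indicator J n \<partial>count_space ?I)"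
      by (intro nn_integral_cong) (auto simp: indicator_def)
    also have "\<dots> = emeasure (count_space ?I) (J \<inter> ?I)"
      by (subst nn_integral_indicator') (auto simp: Int_commute)
    also have "\<dots> < top" using J by (simp add: emeasure_count_space of_nat_less_top)
    finally show ?thesis using False by (simp add: lq_norm_def less_top[symmetric] ennpow_eq_top_iff)
  qed
  have "mixed_norm M p q g \<le> Lp_norm M p (\<lambda>x. (ennreal c * lq_norm ?I q (indicator J)) * indicator A x)"
    unfolding mixed_norm_def
  proof (intro Lp_norm_mono p)
    fix x
    have "lq_norm ?I q (\<lambda>n. g n x) \<le> lq_norm ?I q (\<lambda>n. (ennreal c * indicator A x) * indicator J n)"
      using g by (intro lq_norm_mono q) (simp add: mult_ac)
    also have "\<dots> = (ennreal c * lq_norm ?I q (indicator J)) * indicator A x"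
      by (subst lq_norm_cmult[OF q]) (simp add: mult_ac)
    finally show "lq_norm ?I q (\<lambda>n. g n x) \<le> (ennreal c * lq_norm ?I q (indicator J)) * indicator A x" .
  qed
  also have "\<dots> = (ennreal c * lq_norm ?I q (indicator J)) * Lp_norm M p (indicator A)"
    by (intro Lp_norm_cmult p) measurable
  also have "Lp_norm M p (indicator A) = ennpow (emeasure M A) (1 / p)"
  proof -
    have "(\<integral>\<^sup>+x. ennpow (indicator A x) p \<partial>M) = (\<integral>\<^sup>+x. indicator A x \<partial>M)"
      by (intro nn_integral_cong) (auto simp: indicator_def)
    then show ?thesis by (simp add: Lp_norm_def)
  qed
  also have "(ennreal c * lq_norm ?I q (indicator J)) * ennpow (emeasure M A) (1 / p) < top"
    using fin A by (auto simp: ennreal_mult_eq_top_iff less_top[symmetric] ennpow_eq_top_iff)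
  finally show ?thesis .
qed

text \<open>The bracket between conjugate mixed norm spaces. If \<open>g\<close> is the kernel based
  at a point, this is the truncated potential of \<open>f\<close> there; linearity in
  \<open>g\<close> turns averages over base points into dual potentials.\<close>

definition pairing :: "'a::metric_space measure \<Rightarrow> (int \<Rightarrow> 'a \<Rightarrow> ennreal) \<Rightarrow> (int \<Rightarrow> 'a \<Rightarrow> ennreal) \<Rightarrow> ennreal" where
  "pairing M f g = (\<integral>\<^sup>+x. \<integral>\<^sup>+n. f n x * g n x \<partial>count_space (scales TYPE('a)) \<partial>M)"

lemma pairing_combination_left:
  fixes f :: "int \<Rightarrow> 'a::metric_space \<Rightarrow> ennreal"
  assumes f: "\<And>n. n \<in> scales TYPE('a) \<Longrightarrow> f n \<in> borel_measurable M"
    and f': "\<And>n. n \<in> scales TYPE('a) \<Longrightarrow> f' n \<in> borel_measurable M"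
    and g: "\<And>n. n \<in> scales TYPE('a) \<Longrightarrow> g n \<in> borel_measurable M"
  shows "pairing M (\<lambda>n x. a * f n x + b * f' n x) g = a * pairing M f g + b * pairing M f' g"
proof -
  let ?I = "scales TYPE('a)"
  have [measurable]: "(\<lambda>x. \<integral>\<^sup>+n. f n x * g n x \<partial>count_space ?I) \<in> borel_measurable M"
    "(\<lambda>x. \<integral>\<^sup>+n. f' n x * g n x \<partial>count_space ?I) \<in> borel_measurable M"
    using f f' g by (auto intro!: borel_measurable_nn_integral_count_space)
  have "(\<integral>\<^sup>+n. (a * f n x + b * f' n x) * g n x \<partial>count_space ?I)
    = a * (\<integral>\<^sup>+n. f n x * g n x \<partial>count_space ?I) + b * (\<integral>\<^sup>+n. f' n x * g n x \<partial>count_space ?I)" for x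
    by (simp add: distrib_right nn_integral_add nn_integral_cmult mult.assoc)
  then show ?thesis
    by (simp add: pairing_def nn_integral_add nn_integral_cmult)
qed

lemma pairing_sum_right:
  fixes f :: "int \<Rightarrow> 'a::metric_space \<Rightarrow> ennreal"
  assumes f: "\<And>n. n \<in> scales TYPE('a) \<Longrightarrow> f n \<in> borel_measurable M"
    and g: "\<And>i n. i \<in> F \<Longrightarrow> n \<in> scales TYPE('a) \<Longrightarrow> g i n \<in> borel_measurable M"
  shows "pairing M f (\<lambda>n x. \<Sum>i\<in>F. a i * g i n x) = (\<Sum>i\<in>F. a i * pairing M f (g i))"
proof -
  let ?I = "scales TYPE('a)"
  have m: "(\<lambda>x. \<integral>\<^sup>+n. f n x * g i n x \<partial>count_space ?I) \<in> borel_measurable M" if "i \<in> F" for i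
    using f g that by (auto intro!: borel_measurable_nn_integral_count_space)
  have "(\<integral>\<^sup>+n. f n x * (\<Sum>i\<in>F. a i * g i n x) \<partial>count_space ?I)
    = (\<Sum>i\<in>F. a i * (\<integral>\<^sup>+n. f n x * g i n x \<partial>count_space ?I))" for x
    by (simp add: sum_distrib_left mult.left_commute[of "f _ _"] nn_integral_sum nn_integral_cmult)
  then show ?thesis
    using m by (simp add: pairing_def nn_integral_sum nn_integral_cmult)
qed

text \<open>\<open>finite_alternative\<close> is applied to the vectors of pairings, less
  \<open>1 / t\<close>, of all \<open>f\<close> in the unit ball. The weights obtained form
  \<open>Q\<close>: each such \<open>f\<close> pairs with the averaged kernel to at most
  \<open>1 / t\<close>, and duality turns this into a bound for the norm.\<close>

lemma finite_dual:
  fixes K :: "'a::metric_space \<Rightarrow> int \<Rightarrow> 'a \<Rightarrow> ennreal"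
  assumes p: "1 < p" and q: "1 \<le> q" and J: "finite J" "J \<subseteq> scales TYPE('a)"
    and F: "finite F" "F \<noteq> {}" and A: "A \<in> sets M" "emeasure M A < top"
    and Km: "\<And>i n. i \<in> F \<Longrightarrow> n \<in> scales TYPE('a) \<Longrightarrow> K i n \<in> borel_measurable M"
    and Kb: "\<And>i n x. i \<in> F \<Longrightarrow> K i n x \<le> ennreal c * indicator J n * indicator A x"
    and t: "0 < t"
    and adm: "\<And>f. (\<And>n. n \<in> scales TYPE('a) \<Longrightarrow> f n \<in> borel_measurable M) \<Longrightarrow>
       (\<And>i. i \<in> F \<Longrightarrow> 1 \<le> pairing M f (K i)) \<Longrightarrow> ennreal t \<le> mixed_norm M p q f"
  obtains Q where "set_pmf Q \<subseteq> F"
    "mixed_norm M (p / (p - 1)) (conj_exponent q) (\<lambda>n x. \<Sum>i\<in>F. ennreal (pmf Q i) * K i n x) \<le> ennreal (1 / t)"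
proof -
  let ?I = "scales TYPE('a)"
  let ?B = "{f. (\<forall>n\<in>?I. f n \<in> borel_measurable M) \<and> mixed_norm M p q f \<le> 1}"
  \<comment> \<open>Entries off \<open>F\<close> are set to 0, so that convex combinations agree as
    functions on the whole index type; on \<open>F\<close> the pairings are finite, so
    \<open>enn2real\<close> respects sums and multiples.\<close>
  define S where "S = (\<lambda>f i. if i \<in> F then enn2real (pairing M f (K i)) - 1 / t else 0) ` ?B"
  have r: "0 < p / (p - 1)" using p by simp
  note q' = conj_exponent_ge_1[OF q]
  have fin: "pairing M f (K i) < top" if f: "f \<in> ?B" and i: "i \<in> F" for f i
  proof -
    have "pairing M f (K i) \<le> mixed_norm M p q f * mixed_norm M (p / (p - 1)) (conj_exponent q) (K i)"
      unfolding pairing_def using f i by (intro mixed_norm_Hoelder p q Km) auto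
    also have "\<dots> \<le> 1 * mixed_norm M (p / (p - 1)) (conj_exponent q) (K i)"
      using f by (intro mult_right_mono) auto
    also have "\<dots> < top"
      using mixed_norm_finite[OF r q' J(1) A Kb[OF i]] by simp
    finally show ?thesis .
  qed
  have "\<exists>a. (\<forall>i\<in>F. 0 \<le> a i) \<and> sum a F = 1 \<and> (\<forall>v\<in>S. (\<Sum>i\<in>F. a i * v i) \<le> 0)"
  proof (rule finite_alternative[OF F])
    fix v w and s :: real assume "v \<in> S" "w \<in> S" and s: "0 \<le> s" "s \<le> 1"
    then obtain f g where fg: "f \<in> ?B" "g \<in> ?B"
      "v = (\<lambda>i. if i \<in> F then enn2real (pairing M f (K i)) - 1 / t else 0)"
      "w = (\<lambda>i. if i \<in> F then enn2real (pairing M g (K i)) - 1 / t else 0)"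
      unfolding S_def by blast
    define h where "h = (\<lambda>n x. ennreal (1 - s) * f n x + ennreal s * g n x)"
    have "mixed_norm M p q h \<le> mixed_norm M p q (\<lambda>n x. ennreal (1 - s) * f n x) + mixed_norm M p q (\<lambda>n x. ennreal s * g n x)"
      unfolding h_def using fg p by (intro mixed_norm_triangle q) auto
    also have "\<dots> = ennreal (1 - s) * mixed_norm M p q f + ennreal s * mixed_norm M p q g"
      using fg p q by (subst (1 2) mixed_norm_cmult) auto
    also have "\<dots> \<le> ennreal (1 - s) * 1 + ennreal s * 1"
      using fg by (intro add_mono mult_left_mono) auto
    also have "\<dots> = 1" using s by (simp add: ennreal_plus[symmetric] del: ennreal_plus)
    finally have "mixed_norm M p q h \<le> 1" .
    moreover have "h n \<in> borel_measurable M" if "n \<in> ?I" for n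
    proof -
      have [measurable]: "f n \<in> borel_measurable M" "g n \<in> borel_measurable M" using fg that by auto
      show ?thesis unfolding h_def by measurable
    qed
    ultimately have hB: "h \<in> ?B" by auto
    have "enn2real (pairing M h (K i)) = (1 - s) * enn2real (pairing M f (K i)) + s * enn2real (pairing M g (K i))"
      if i: "i \<in> F" for i
    proof -
      have "pairing M h (K i) = ennreal (1 - s) * pairing M f (K i) + ennreal s * pairing M g (K i)"
        unfolding h_def using fg i by (intro pairing_combination_left Km) auto
      then show ?thesis using fin[OF fg(1) i] fin[OF fg(2) i] s
        by (simp add: enn2real_plus enn2real_mult ennreal_mult_less_top)
    qed
    then have "(\<lambda>i. (1 - s) * v i + s * w i) = (\<lambda>i. if i \<in> F then enn2real (pairing M h (K i)) - 1 / t else 0)"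
      by (auto simp: fg algebra_simps)
    then show "(\<lambda>i. (1 - s) * v i + s * w i) \<in> S"
      unfolding S_def using hB by (simp add: image_iff) blast
  next
    fix v assume "v \<in> S"
    then obtain f where f: "f \<in> ?B" "v = (\<lambda>i. if i \<in> F then enn2real (pairing M f (K i)) - 1 / t else 0)"
      unfolding S_def by blast
    show "\<exists>i\<in>F. v i \<le> 0"
    proof (rule ccontr)
      assume "\<not> ?thesis"
      then have gt: "1 / t < enn2real (pairing M f (K i))" if "i \<in> F" for i using that f by force
      \<comment> \<open>If every pairing exceeded \<open>1 / t\<close>, then \<open>f / c\<close>
        would be admissible although its norm is at most \<open>1 / c < t\<close>.\<close>
      define c where "c = Min ((\<lambda>i. enn2real (pairing M f (K i))) ` F)"
      have c: "1 / t < c" using gt F by (auto simp: c_def)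
      have c0: "0 < c" using c t by (smt (verit) divide_pos_pos)
      have cle: "c \<le> enn2real (pairing M f (K i))" if "i \<in> F" for i using that F by (auto simp: c_def)
      have "ennreal t \<le> mixed_norm M p q (\<lambda>n x. ennreal (1 / c) * f n x)"
      proof (rule adm)
        show "(\<lambda>x. ennreal (1 / c) * f n x) \<in> borel_measurable M" if "n \<in> ?I" for n using f that by auto
        fix i assume i: "i \<in> F"
        have "1 = ennreal (1 / c) * ennreal c" using c0 by (simp add: ennreal_mult[symmetric])
        also have "ennreal c \<le> pairing M f (K i)"
          using ennreal_leI[OF cle[OF i]] fin[OF f(1) i] by simp
        then have "ennreal (1 / c) * ennreal c \<le> ennreal (1 / c) * pairing M f (K i)"
          by (rule mult_left_mono) simp
        also have "\<dots> = pairing M (\<lambda>n x. ennreal (1 / c) * f n x) (K i)"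
          using pairing_combination_left[of f M f "K i" "ennreal (1 / c)" 0] f i Km by simp
        finally show "1 \<le> pairing M (\<lambda>n x. ennreal (1 / c) * f n x) (K i)" .
      qed
      also have "\<dots> = ennreal (1 / c) * mixed_norm M p q f"
        using f p q by (intro mixed_norm_cmult) auto
      also have "\<dots> \<le> ennreal (1 / c) * 1" using f by (intro mult_left_mono) auto
      finally have "t \<le> 1 / c" using c0 by (simp add: ennreal_le_iff)
      then show False using c c0 t by (simp add: field_simps)
    qed
  qed
  then obtain a where a: "\<And>i. i \<in> F \<Longrightarrow> 0 \<le> a i" "sum a F = 1"
    "\<And>v. v \<in> S \<Longrightarrow> (\<Sum>i\<in>F. a i * v i) \<le> 0" by blast
  define Q where "Q = embed_pmf (\<lambda>i. if i \<in> F then a i else 0)"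
  have one: "(\<integral>\<^sup>+i. ennreal (if i \<in> F then a i else 0) \<partial>count_space UNIV) = 1"
  proof -
    have "(\<integral>\<^sup>+i. ennreal (if i \<in> F then a i else 0) \<partial>count_space UNIV) = (\<Sum>i\<in>F. ennreal (a i))"
      using F by (subst nn_integral_count_space'[of F]) auto
    then show ?thesis using a by (simp add: sum_ennreal)
  qed
  have Q: "pmf Q i = (if i \<in> F then a i else 0)" for i
    unfolding Q_def using a one by (subst pmf_embed_pmf) auto
  have QF: "set_pmf Q \<subseteq> F" using Q by (auto simp: set_pmf_iff split: if_splits)
  let ?g = "\<lambda>n x. \<Sum>i\<in>F. ennreal (pmf Q i) * K i n x"
  have gb: "?g n x \<le> ennreal c * indicator J n * indicator A x" for n x
  proof -
    have "?g n x \<le> (\<Sum>i\<in>F. ennreal (pmf Q i) * (ennreal c * indicator J n * indicator A x))"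
      by (intro sum_mono mult_left_mono Kb) auto
    also have "\<dots> = (\<Sum>i\<in>F. ennreal (pmf Q i)) * (ennreal c * indicator J n * indicator A x)"
      by (rule sum_distrib_right[symmetric])
    also have "(\<Sum>i\<in>F. ennreal (pmf Q i)) = 1" using a by (simp add: Q sum_ennreal)
    finally show ?thesis by simp
  qed
  have "mixed_norm M (p / (p - 1)) (conj_exponent q) ?g \<le> ennreal (1 / t)"
  proof (rule mixed_norm_le_dual[OF p q J])
    show "(\<lambda>x. ?g n x) \<in> borel_measurable M" if "n \<in> ?I" for n using Km that by auto
    show "?g n x = 0" if "n \<notin> J" for n x using gb[of n x] that by simp
    show "?g n x < top" for n x
      by (rule order_le_less_trans[OF gb]) (auto simp: ennreal_mult_less_top indicator_def)
    show "mixed_norm M (p / (p - 1)) (conj_exponent q) ?g < top"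
      by (rule mixed_norm_finite[OF r q' J(1) A gb])
    fix f assume f: "\<And>n. n \<in> ?I \<Longrightarrow> f n \<in> borel_measurable M" "mixed_norm M p q f \<le> 1"
    then have fB: "f \<in> ?B" by auto
    have "(\<lambda>i. if i \<in> F then enn2real (pairing M f (K i)) - 1 / t else 0) \<in> S"
      unfolding S_def using fB by blast
    from a(3)[OF this] have "(\<Sum>i\<in>F. a i * (enn2real (pairing M f (K i)) - 1 / t)) \<le> 0" by simp
    then have le: "(\<Sum>i\<in>F. a i * enn2real (pairing M f (K i))) \<le> 1 / t"
      using a(2) by (simp add: right_diff_distrib sum_subtractf sum_divide_distrib[symmetric])
    have "pairing M f ?g = (\<Sum>i\<in>F. ennreal (pmf Q i) * pairing M f (K i))"
      by (intro pairing_sum_right f Km)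
    also have "\<dots> = (\<Sum>i\<in>F. ennreal (a i * enn2real (pairing M f (K i))))"
      using a(1) fin[OF fB] by (intro sum.cong) (auto simp: Q ennreal_mult)
    also have "\<dots> = ennreal (\<Sum>i\<in>F. a i * enn2real (pairing M f (K i)))"
      using a(1) by (intro sum_ennreal) auto
    also have "\<dots> \<le> ennreal (1 / t)" using le by (rule ennreal_leI)
    finally show "(\<integral>\<^sup>+x. \<integral>\<^sup>+n. f n x * ?g n x \<partial>count_space ?I \<partial>M) \<le> ennreal (1 / t)"
      by (simp add: pairing_def)
  qed
  then show ?thesis using that QF by blast
qed

section \<open>Weak limits of finitely supported measures on a compact set\<close>

text \<open>The first differing digit contributes \<open>(1/3) ^ n\<close>, all later ones together
  at most half of that. In base 2 the tail could cancel the leading difference.\<close>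

lemma ternary_digits_separate:
  fixes b c :: "nat \<Rightarrow> bool"
  assumes "b n \<noteq> c n" and before: "\<And>i. i < n \<Longrightarrow> b i = c i"
  shows "(1/3) ^ n / 2 \<le> \<bar>(\<Sum>i. of_bool (b i) * (1/3 :: real) ^ i) - (\<Sum>i. of_bool (c i) * (1/3) ^ i)\<bar>"
proof -
  define d where "d i = (of_bool (b i) - of_bool (c i)) * (1/3 :: real) ^ i" for i
  have geo: "summable (\<lambda>i. (1/3 :: real) ^ i)" by (rule summable_geometric) simp
  have sm: "summable (\<lambda>i. of_bool (P i) * (1/3 :: real) ^ i)" for P
    by (rule summable_comparison_test'[OF geo, of 0]) auto
  have sd: "summable d"
    unfolding d_def left_diff_distrib by (intro summable_diff sm)
  have eq: "(\<Sum>i. of_bool (b i) * (1/3 :: real) ^ i) - (\<Sum>i. of_bool (c i) * (1/3) ^ i) = suminf d"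
    unfolding d_def left_diff_distrib by (intro suminf_diff sm)
  have "suminf d = (\<Sum>i. d (i + Suc n)) + (\<Sum>i<Suc n. d i)"
    by (rule suminf_split_initial_segment[OF sd])
  also have "(\<Sum>i<Suc n. d i) = d n"
    using before by (simp add: d_def)
  finally have *: "suminf d = (\<Sum>i. d (i + Suc n)) + d n" .
  have "\<bar>\<Sum>i. d (i + Suc n)\<bar> \<le> (\<Sum>i. (1/3) ^ Suc n * (1/3) ^ i)"
  proof -
    have s2: "summable (\<lambda>i. (1/3) ^ Suc n * (1/3 :: real) ^ i)" by (intro summable_mult geo)
    have le: "norm (d (i + Suc n)) \<le> (1/3) ^ Suc n * (1/3) ^ i" for i
      by (auto simp: d_def abs_mult power_add)
    have "norm (\<Sum>i. d (i + Suc n)) \<le> (\<Sum>i. norm (d (i + Suc n)))"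
      by (intro summable_norm summable_comparison_test'[OF s2, of 0]) (use le in auto)
    also have "\<dots> \<le> (\<Sum>i. (1/3) ^ Suc n * (1/3) ^ i)"
      by (intro suminf_le le s2 summable_comparison_test'[OF s2, of 0]) (use le in auto)
    finally show ?thesis by simp
  qed
  also have "\<dots> = (1/3) ^ n / 2"
    by (subst suminf_mult[OF geo]) (simp add: suminf_geometric)
  finally have "\<bar>\<Sum>i. d (i + Suc n)\<bar> \<le> (1/3) ^ n / 2" .
  moreover have "\<bar>d n\<bar> = (1/3) ^ n" using assms(1) by (auto simp: d_def abs_mult)
  ultimately show ?thesis unfolding eq * by linarith
qed

lemma compact_finite_nets:
  fixes E :: "'a::metric_space set"
  assumes "compact E"
  obtains F where "\<And>m. finite (F m)" "\<And>m. E \<subseteq> (\<Union>x\<in>F m. ball x (1 / real (Suc m)))"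
proof -
  have "\<forall>e>0. \<exists>k. finite k \<and> E \<subseteq> (\<Union>x\<in>k. ball x e)"
    using assms unfolding compact_eq_totally_bounded by (rule conjunct2)
  then have "\<exists>k. finite k \<and> E \<subseteq> (\<Union>x\<in>k. ball x (1 / real (Suc m)))" for m
    by (rule allE[of _ "1 / real (Suc m)"]) (erule impE, simp)
  then show ?thesis using that by metis
qed

text \<open>The digits of \<open>h x\<close> record which balls of finite nets of all levels contain
  \<open>x\<close>. Close codes agree in their first digits and so share a small ball. Thus the
  inverse of \<open>h\<close> is uniformly continuous on \<open>E\<close>, while \<open>h\<close>
  may jump at the boundaries of the balls.\<close>

lemma compact_real_coding:
  fixes E :: "'a::metric_space set"
  assumes "compact E"
  obtains h :: "'a \<Rightarrow> real" where "\<And>x. h x \<in> {0..2}"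
    "\<And>e. 0 < e \<Longrightarrow> \<exists>\<delta>>0. \<forall>x\<in>E. \<forall>y\<in>E. \<bar>h x - h y\<bar> < \<delta> \<longrightarrow> dist x y < e"
proof -
  obtain F where F: "\<And>m. finite (F m)" "\<And>m. E \<subseteq> (\<Union>x\<in>F m. ball x (1 / real (Suc m)))"
    using compact_finite_nets[OF assms] by blast
  \<comment> \<open>The empty set is added so that the family can be enumerated even if all nets are
    empty.\<close>
  define C where "C = insert {} (\<Union>m. (\<lambda>x. ball x (1 / real (Suc m))) ` F m)"
  have C: "countable C" "C \<noteq> {}" by (auto simp: C_def F(1) countable_finite)
  define B where "B = from_nat_into C"
  define h where "h x = (\<Sum>i. of_bool (x \<in> B i) * (1/3 :: real) ^ i)" for x
  have geo: "summable (\<lambda>i. (1/3 :: real) ^ i)" by (rule summable_geometric) simp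
  have sm: "summable (\<lambda>i. of_bool (P i) * (1/3 :: real) ^ i)" for P
    by (rule summable_comparison_test'[OF geo, of 0]) auto
  have "h x \<le> (\<Sum>i. (1/3 :: real) ^ i)" for x
    unfolding h_def by (intro suminf_le sm geo) auto
  moreover have "(\<Sum>i. (1/3 :: real) ^ i) \<le> 2" by (simp add: suminf_geometric)
  moreover have "0 \<le> h x" for x unfolding h_def by (intro suminf_nonneg sm) auto
  ultimately have h02: "h x \<in> {0..2}" for x by (auto intro: order_trans)
  moreover have "\<exists>\<delta>>0. \<forall>x\<in>E. \<forall>y\<in>E. \<bar>h x - h y\<bar> < \<delta> \<longrightarrow> dist x y < e" if e: "0 < e" for e
  proof -
    obtain m where m: "1 / real (Suc m) < e / 2"
      using e reals_Archimedean[of "e/2"] by (auto simp: inverse_eq_divide)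
    have "\<exists>i. B i = ball x (1 / real (Suc m))" if "x \<in> F m" for x
    proof -
      have "ball x (1 / real (Suc m)) \<in> C" using that by (auto simp: C_def)
      then show ?thesis unfolding B_def using C(1) by (metis from_nat_into_surj)
    qed
    then obtain i where i: "\<And>x. x \<in> F m \<Longrightarrow> B (i x) = ball x (1 / real (Suc m))" by metis
    obtain k where k: "\<And>x. x \<in> F m \<Longrightarrow> i x \<le> k"
      using finite_nat_set_iff_bounded_le[of "i ` F m"] F(1) by auto
    \<comment> \<open>\<open>k\<close> bounds the chosen positions of all balls of level
      \<open>m\<close>, and \<open>(1/3) ^ k / 2\<close> is a lower bound for the gap between codes
      that differ at some position up to \<open>k\<close>.\<close>
    show ?thesis
    proof (intro exI[of _ "(1/3) ^ k / 2"] conjI ballI impI)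
      fix x y assume xy: "x \<in> E" "y \<in> E" "\<bar>h x - h y\<bar> < (1/3) ^ k / 2"
      have same: "x \<in> B j \<longleftrightarrow> y \<in> B j" if "j \<le> k" for j
      proof (rule ccontr)
        assume ne: "(x \<in> B j) \<noteq> (y \<in> B j)"
        define j0 where "j0 = (LEAST j. (x \<in> B j) \<noteq> (y \<in> B j))"
        have j0: "(x \<in> B j0) \<noteq> (y \<in> B j0)" unfolding j0_def by (rule LeastI[of _ j]) (rule ne)
        have le: "j0 \<le> j" unfolding j0_def by (rule Least_le) (rule ne)
        have "(x \<in> B i) = (y \<in> B i)" if "i < j0" for i
          using not_less_Least[of i "\<lambda>j. (x \<in> B j) \<noteq> (y \<in> B j)"] that by (simp add: j0_def)
        then have "(1/3) ^ j0 / 2 \<le> \<bar>h x - h y\<bar>"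
          unfolding h_def by (rule ternary_digits_separate[where b = "\<lambda>i. x \<in> B i" and c = "\<lambda>i. y \<in> B i", OF j0])
        moreover have "(1/3 :: real) ^ k \<le> (1/3) ^ j0"
          using le that by (intro power_decreasing) auto
        ultimately show False using xy by linarith
      qed
      obtain z where z: "z \<in> F m" "x \<in> ball z (1 / real (Suc m))" using F(2)[of m] xy by auto
      then have "y \<in> ball z (1 / real (Suc m))" using same[OF k[OF z(1)]] i by auto
      then have "dist x y < 2 / real (Suc m)"
        using z dist_triangle3[of x y z] by auto
      then show "dist x y < e" using m by simp
    qed auto
  qed
  ultimately show ?thesis using that by blast
qed

text \<open>Skorohod's representation replaces weak convergence by pointwise convergence; indicators
  of open sets are lower semicontinuous, so Fatou's lemma applies.\<close>

lemma weak_conv_open: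
  fixes \<mu> :: "nat \<Rightarrow> real measure"
  assumes \<mu>: "\<And>n. real_distribution (\<mu> n)" and M: "real_distribution M"
    and w: "weak_conv_m \<mu> M" and U: "open U"
  shows "emeasure M U \<le> liminf (\<lambda>n. emeasure (\<mu> n) U)"
proof -
  obtain \<Omega> :: "real measure" and X and Y where XY:
    "\<And>n. X n \<in> measurable \<Omega> borel" "\<And>n. distr \<Omega> borel (X n) = \<mu> n"
    "Y \<in> measurable \<Omega> lborel" "distr \<Omega> borel Y = M"
    "\<And>x. x \<in> space \<Omega> \<Longrightarrow> (\<lambda>n. X n x) \<longlonglongrightarrow> Y x"
    using Skorohod[OF \<mu> M w] by blast
  have [measurable]: "Y \<in> borel_measurable \<Omega>" "\<And>n. X n \<in> borel_measurable \<Omega>" "U \<in> sets borel"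
    using XY U by auto
  have "emeasure M U = (\<integral>\<^sup>+x. indicator U x \<partial>M)"
    using real_distribution.events_eq_borel[OF M] by simp
  also have "\<dots> = (\<integral>\<^sup>+x. indicator U (Y x) \<partial>\<Omega>)"
    unfolding XY(4)[symmetric] by (subst nn_integral_distr) auto
  also have "\<dots> \<le> (\<integral>\<^sup>+x. liminf (\<lambda>n. indicator U (X n x)) \<partial>\<Omega>)"
  proof (rule nn_integral_mono)
    fix x assume x: "x \<in> space \<Omega>"
    show "indicator U (Y x) \<le> liminf (\<lambda>n. indicator U (X n x) :: ennreal)"
    proof (cases "Y x \<in> U")
      case True
      have "\<forall>\<^sub>F n in sequentially. X n x \<in> U"
        using topological_tendstoD[OF XY(5)[OF x] U True] .
      then have "\<forall>\<^sub>F n in sequentially. 1 \<le> (indicator U (X n x) :: ennreal)"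
        by eventually_elim simp
      then show ?thesis using True by (simp add: Liminf_bounded)
    qed simp
  qed
  also have "\<dots> \<le> liminf (\<lambda>n. \<integral>\<^sup>+x. indicator U (X n x) \<partial>\<Omega>)"
    by (intro nn_integral_liminf) measurable
  also have "(\<lambda>n. \<integral>\<^sup>+x. indicator U (X n x) \<partial>\<Omega>) = (\<lambda>n. emeasure (\<mu> n) U)"
  proof
    fix n
    have "emeasure (\<mu> n) U = (\<integral>\<^sup>+x. indicator U x \<partial>\<mu> n)"
      using real_distribution.events_eq_borel[OF \<mu>] by simp
    also have "\<dots> = (\<integral>\<^sup>+x. indicator U (X n x) \<partial>\<Omega>)"
      unfolding XY(2)[symmetric] by (subst nn_integral_distr) auto
    finally show "(\<integral>\<^sup>+x. indicator U (X n x) \<partial>\<Omega>) = emeasure (\<mu> n) U" by simp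
  qed
  finally show ?thesis .
qed

text \<open>The inverse of the code is uniformly continuous with values in a compact, hence
  complete, set, so it extends to the closure. The closure matters because a weak limit may charge
  limits of codes that are not codes themselves.\<close>

lemma coding_inverse:
  fixes E :: "'a::metric_space set" and h :: "'a \<Rightarrow> real"
  assumes E: "compact E"
    and h: "\<And>e. 0 < e \<Longrightarrow> \<exists>\<delta>>0. \<forall>x\<in>E. \<forall>y\<in>E. \<bar>h x - h y\<bar> < \<delta> \<longrightarrow> dist x y < e"
  obtains \<phi> where "continuous_on (closure (h ` E)) \<phi>" "\<phi> ` closure (h ` E) \<subseteq> E" "\<And>x. x \<in> E \<Longrightarrow> \<phi> (h x) = x"
proof -
  \<comment> \<open>\<open>y\<close> is a subsequential limit of points whose codes tend to
    \<open>t\<close>. That one and the same \<open>x\<close> approximates \<open>t\<close> by its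
    code and \<open>y\<close> by its position yields both continuity and
    \<open>\<phi> (h x) = x\<close>.\<close>
  have "\<exists>y\<in>E. \<forall>e>0. \<exists>x\<in>E. \<bar>h x - t\<bar> < e \<and> dist x y < e" if "t \<in> closure (h ` E)" for t
  proof -
    have "\<exists>s. (\<forall>n. s n \<in> h ` E) \<and> s \<longlonglongrightarrow> t"
      using that unfolding closure_sequential .
    then obtain s where s: "\<And>n. s n \<in> h ` E" "s \<longlonglongrightarrow> t" by auto
    have "\<forall>n. \<exists>y. y \<in> E \<and> s n = h y" using s(1) by blast
    then obtain x where "\<forall>n. x n \<in> E \<and> s n = h (x n)" by (rule choice[THEN exE])
    then have x: "\<And>n. x n \<in> E" "\<And>n. s n = h (x n)" by auto
    obtain y r where y: "y \<in> E" "strict_mono (r :: nat \<Rightarrow> nat)" "(x \<circ> r) \<longlonglongrightarrow> y"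
      using E x(1) unfolding compact_def by blast
    have hs: "(s \<circ> r) \<longlonglongrightarrow> t" by (rule LIMSEQ_subseq_LIMSEQ[OF s(2) y(2)])
    show ?thesis
    proof (rule bexI[OF _ y(1)], intro allI impI)
      fix e :: real assume "0 < e"
      then have "\<forall>\<^sub>F n in sequentially. dist ((x \<circ> r) n) y < e \<and> dist ((s \<circ> r) n) t < e"
        using tendstoD[OF y(3)] tendstoD[OF hs] by (intro eventually_conj) auto
      then obtain n where "dist ((x \<circ> r) n) y < e \<and> dist ((s \<circ> r) n) t < e"
        using eventually_happens trivial_limit_sequentially by blast
      then show "\<exists>x\<in>E. \<bar>h x - t\<bar> < e \<and> dist x y < e"
        using x by (intro bexI[of _ "x (r n)"]) (auto simp: dist_real_def)
    qed
  qed
  then obtain \<phi> where \<phi>: "\<And>t. t \<in> closure (h ` E) \<Longrightarrow> \<phi> t \<in> E"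
    "\<And>t e. t \<in> closure (h ` E) \<Longrightarrow> 0 < e \<Longrightarrow> \<exists>x\<in>E. \<bar>h x - t\<bar> < e \<and> dist x (\<phi> t) < e"
    by metis
  show ?thesis
  proof
    show "continuous_on (closure (h ` E)) \<phi>"
      unfolding continuous_on_iff
    proof (intro ballI allI impI)
      fix t e :: real assume t: "t \<in> closure (h ` E)" and e: "0 < e"
      obtain \<delta> where \<delta>: "0 < \<delta>" "\<And>x y. x \<in> E \<Longrightarrow> y \<in> E \<Longrightarrow> \<bar>h x - h y\<bar> < \<delta> \<Longrightarrow> dist x y < e / 3"
        using h[of "e / 3"] e by auto
      show "\<exists>d>0. \<forall>t'\<in>closure (h ` E). dist t' t < d \<longrightarrow> dist (\<phi> t') (\<phi> t) < e"
      proof (intro exI[of _ "\<delta> / 3"] conjI ballI impI)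
        fix t' assume t': "t' \<in> closure (h ` E)" "dist t' t < \<delta> / 3"
        define m where "m = min (\<delta> / 3) (e / 3)"
        have m: "0 < m" using \<delta> e by (auto simp: m_def)
        obtain x where x: "x \<in> E" "\<bar>h x - t\<bar> < m" "dist x (\<phi> t) < m" using \<phi>(2)[OF t m] by auto
        obtain x' where x': "x' \<in> E" "\<bar>h x' - t'\<bar> < m" "dist x' (\<phi> t') < m" using \<phi>(2)[OF t'(1) m] by auto
        have "\<bar>h x' - h x\<bar> < \<delta>" using x x' t' by (auto simp: m_def dist_real_def abs_if split: if_splits)
        then have "dist x' x < e / 3" using \<delta>(2) x x' by blast
        then show "dist (\<phi> t') (\<phi> t) < e"
          using x(3) x'(3) dist_triangle[of "\<phi> t'" "\<phi> t" x'] dist_triangle[of x' "\<phi> t" x]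
          by (auto simp: m_def dist_commute)
      qed (use \<delta> in auto)
    qed
    show "\<phi> ` closure (h ` E) \<subseteq> E" using \<phi>(1) by auto
    fix x assume x: "x \<in> E"
    then have cl: "h x \<in> closure (h ` E)" by (intro closure_subset[THEN subsetD]) auto
    have "dist x (\<phi> (h x)) < 2 * e" if e: "0 < e" for e
    proof -
      obtain \<delta> where \<delta>: "0 < \<delta>" "\<And>x y. x \<in> E \<Longrightarrow> y \<in> E \<Longrightarrow> \<bar>h x - h y\<bar> < \<delta> \<Longrightarrow> dist x y < e"
        using h[of e] e by auto
      obtain x' where x': "x' \<in> E" "\<bar>h x' - h x\<bar> < min \<delta> e" "dist x' (\<phi> (h x)) < min \<delta> e"
        using \<phi>(2)[OF cl, of "min \<delta> e"] \<delta> e by auto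
      have "dist x' x < e" using \<delta>(2)[of x' x] x x' by auto
      then show ?thesis using x' dist_triangle[of x "\<phi> (h x)" x'] by (auto simp: dist_commute)
    qed
    from this[of "dist x (\<phi> (h x)) / 2"] show "\<phi> (h x) = x" by (cases "x = \<phi> (h x)") auto
  qed
qed

text \<open>Continuous images of compact sets are compact, so inner regularity passes from the line
  to \<open>E\<close>. Outer regularity follows by taking complements in \<open>E\<close>.\<close>

lemma distr_in_radon_measures:
  fixes \<phi> :: "real \<Rightarrow> 'a::metric_space"
  assumes P: "finite_measure P" "sets P = sets borel" and C: "closed C" "emeasure P (- C) = 0"
    and E: "compact E" and \<phi>: "continuous_on C \<phi>" "\<phi> ` C \<subseteq> E"
  defines "\<nu> \<equiv> distr (restrict_space P C) (restrict_space borel E) \<phi>"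
  shows "\<nu> \<in> radon_measures E"
    and "\<And>A. A \<in> sets \<nu> \<Longrightarrow> emeasure \<nu> A = emeasure P (\<phi> -` A \<inter> C)"
proof -
  interpret P: finite_measure P by fact
  have Cs: "C \<in> sets P" using P C by auto
  have spP: "space P = UNIV" using sets_eq_imp_space_eq[OF P(2)] by simp
  have \<phi>m: "\<phi> \<in> measurable (restrict_space P C) (restrict_space borel E)"
  proof (rule measurable_restrict_space2)
    show "\<phi> \<in> space (restrict_space P C) \<rightarrow> E" using \<phi> by (auto simp: space_restrict_space)
    have "\<phi> \<in> measurable (restrict_space borel C) borel"
      using \<phi>(1) by (rule borel_measurable_continuous_on_restrict)
    then show "\<phi> \<in> measurable (restrict_space P C) borel"
      using measurable_cong_sets[OF sets_restrict_space_cong[OF P(2)] refl] by blast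
  qed
  have sp: "space \<nu> = E" "sets \<nu> = sets (restrict_space borel E)"
    by (auto simp: \<nu>_def space_restrict_space)
  show em: "emeasure \<nu> A = emeasure P (\<phi> -` A \<inter> C)" if "A \<in> sets \<nu>" for A
  proof -
    have A: "A \<in> sets (restrict_space borel E)" using that sp by simp
    have "emeasure \<nu> A = emeasure (restrict_space P C) (\<phi> -` A \<inter> space (restrict_space P C))"
      unfolding \<nu>_def by (rule emeasure_distr[OF \<phi>m A])
    also have "\<phi> -` A \<inter> space (restrict_space P C) = \<phi> -` A \<inter> C"
      by (auto simp: space_restrict_space spP)
    finally show ?thesis using Cs by (subst (asm) emeasure_restrict_space) (auto simp: Int_absorb2 spP)
  qed
  have pre: "\<phi> -` A \<inter> C \<in> sets P" if "A \<in> sets \<nu>" for A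
    using measurable_sets[OF \<phi>m, of A] that Cs sp
    by (auto simp: space_restrict_space spP sets_restrict_space_iff)
  have fin: "emeasure \<nu> A \<noteq> top" if "A \<in> sets \<nu>" for A
    by (subst em[OF that]) simp
  have Eb: "E \<in> sets borel" using E by (simp add: compact_imp_closed borel_closed)
  have ES: "E \<in> sets \<nu>" using sets.top[of \<nu>] sp by simp
  have cpt: "K \<in> sets \<nu>" if "compact K" "K \<subseteq> E" for K
    using that Eb by (auto simp: sp sets_restrict_space_iff compact_imp_closed borel_closed)
  have inner: "emeasure \<nu> F = (SUP K \<in> {K. K \<subseteq> F \<and> compact K}. emeasure \<nu> K)" if F: "F \<in> sets \<nu>" for F
  proof (rule antisym)
    have FE: "F \<subseteq> E" using sets.sets_into_space[OF F] sp by simp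
    have "emeasure \<nu> F = emeasure P (\<phi> -` F \<inter> C)" by (rule em[OF F])
    also have "\<dots> = (SUP K \<in> {K. K \<subseteq> \<phi> -` F \<inter> C \<and> compact K}. emeasure P K)"
      using pre[OF F] P by (intro inner_regular) auto
    also have "\<dots> \<le> (SUP K \<in> {K. K \<subseteq> F \<and> compact K}. emeasure \<nu> K)"
    proof (rule SUP_mono)
      fix K assume "K \<in> {K. K \<subseteq> \<phi> -` F \<inter> C \<and> compact K}"
      then have K: "K \<subseteq> C" "\<phi> ` K \<subseteq> F" "compact K" by auto
      have c: "compact (\<phi> ` K)"
        using K \<phi> by (intro compact_continuous_image) (auto intro: continuous_on_subset)
      have s: "\<phi> ` K \<in> sets \<nu>" using c K FE by (intro cpt) auto
      have "emeasure P K \<le> emeasure \<nu> (\<phi> ` K)"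
        unfolding em[OF s] using K by (intro emeasure_mono pre s) auto
      then show "\<exists>L\<in>{K. K \<subseteq> F \<and> compact K}. emeasure P K \<le> emeasure \<nu> L" using c K by auto
    qed
    finally show "emeasure \<nu> F \<le> (SUP K \<in> {K. K \<subseteq> F \<and> compact K}. emeasure \<nu> K)" .
    show "(SUP K \<in> {K. K \<subseteq> F \<and> compact K}. emeasure \<nu> K) \<le> emeasure \<nu> F"
      by (rule SUP_least) (auto intro!: emeasure_mono F)
  qed
  have outer: "emeasure \<nu> F = (INF U \<in> {U. F \<subseteq> U \<and> openin (top_of_set E) U}. emeasure \<nu> U)" if F: "F \<in> sets \<nu>" for F
  proof (rule antisym)
    have FE: "F \<subseteq> E" using sets.sets_into_space[OF F] sp by simp
    have open_s: "U \<in> sets \<nu>" if "openin (top_of_set E) U" for U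
      using that Eb by (auto simp: openin_open sp sets_restrict_space_iff)
    show "emeasure \<nu> F \<le> (INF U \<in> {U. F \<subseteq> U \<and> openin (top_of_set E) U}. emeasure \<nu> U)"
      by (rule INF_greatest) (auto intro!: emeasure_mono open_s)
    define i where "i = (INF U \<in> {U. F \<subseteq> U \<and> openin (top_of_set E) U}. emeasure \<nu> U)"
    have EF: "E - F \<in> sets \<nu>" using ES F by auto
    \<comment> \<open>For compact \<open>K\<close> inside \<open>E - F\<close>, the set
      \<open>E - K\<close> is open in \<open>E\<close> and contains \<open>F\<close>, so its mass is
      at least \<open>i\<close>. Inner regularity of \<open>E - F\<close> and cancellation of its
      finite mass then give the claim.\<close>
    have "i + emeasure \<nu> (E - F) = (SUP K \<in> {K. K \<subseteq> E - F \<and> compact K}. i + emeasure \<nu> K)"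
      unfolding inner[OF EF] by (rule ennreal_SUP_add_right) auto
    also have "\<dots> \<le> emeasure \<nu> E"
    proof (rule SUP_least)
      fix K assume "K \<in> {K. K \<subseteq> E - F \<and> compact K}"
      then have K: "K \<subseteq> E - F" "compact K" by auto
      then have KS: "K \<in> sets \<nu>" by (intro cpt) auto
      have U: "openin (top_of_set E) (E - K)"
        using K by (auto simp: openin_open compact_imp_closed open_Compl intro!: exI[of _ "- K"])
      have "i + emeasure \<nu> K \<le> emeasure \<nu> (E - K) + emeasure \<nu> K"
        unfolding i_def using K U FE by (intro add_right_mono INF_lower) auto
      also have "\<dots> = emeasure \<nu> E"
        using K KS ES by (subst plus_emeasure) (auto intro!: arg_cong[where f="emeasure \<nu>"])
      finally show "i + emeasure \<nu> K \<le> emeasure \<nu> E" .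
    qed
    also have "emeasure \<nu> E = emeasure \<nu> F + emeasure \<nu> (E - F)"
      using F EF FE by (subst plus_emeasure) (auto intro!: arg_cong[where f="emeasure \<nu>"])
    finally show "(INF U \<in> {U. F \<subseteq> U \<and> openin (top_of_set E) U}. emeasure \<nu> U) \<le> emeasure \<nu> F"
      using fin[OF EF] unfolding i_def[symmetric] by (simp add: add.commute ennreal_add_left_cancel_le)
  qed
  show "\<nu> \<in> radon_measures E"
    using sp fin[OF ES] inner outer by (simp add: radon_measures_def less_top)
qed

text \<open>The limit on the line is carried by the closure of the codes and pulled back by
  \<open>\<phi>\<close>. Continuity is asked of \<open>\<phi>\<close> alone: open sets of the space
  correspond along it to relatively open sets of codes, and on the supports of the
  \<open>Q k\<close> it inverts \<open>h\<close>.\<close>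

lemma weak_limit_pmf:
  fixes E :: "'a::metric_space set" and Q :: "nat \<Rightarrow> 'a pmf"
  assumes E: "compact E" "E \<noteq> {}" and Q: "\<And>k. set_pmf (Q k) \<subseteq> E"
  obtains \<nu> r where "\<nu> \<in> radon_measures E" "strict_mono (r :: nat \<Rightarrow> nat)" "emeasure \<nu> E = 1"
    "\<And>U. open U \<Longrightarrow> emeasure \<nu> (U \<inter> E) \<le> liminf (\<lambda>k. emeasure (measure_pmf (Q (r k))) U)"
proof -
  obtain h :: "'a \<Rightarrow> real" where h: "\<And>x. h x \<in> {0..2}"
    "\<And>e. 0 < e \<Longrightarrow> \<exists>\<delta>>0. \<forall>x\<in>E. \<forall>y\<in>E. \<bar>h x - h y\<bar> < \<delta> \<longrightarrow> dist x y < e"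
    using compact_real_coding[OF E(1)] by blast
  define C where "C = closure (h ` E)"
  obtain \<phi> where \<phi>: "continuous_on C \<phi>" "\<phi> ` C \<subseteq> E" "\<And>x. x \<in> E \<Longrightarrow> \<phi> (h x) = x"
    using coding_inverse[OF E(1) h(2)] unfolding C_def by blast
  \<comment> \<open>Every function is measurable for \<open>measure_pmf\<close>, so pushing forward
    along a discontinuous \<open>h\<close> is legitimate.\<close>
  define R where "R k = distr (measure_pmf (Q k)) borel h" for k
  have R: "real_distribution (R k)" for k
    unfolding R_def real_distribution_def real_distribution_axioms_def
    by (auto intro!: prob_space.prob_space_distr prob_space_measure_pmf)
  have Rem: "emeasure (R k) A = emeasure (measure_pmf (Q k)) (h -` A)" if "A \<in> sets borel" for A k
    using that by (simp add: R_def emeasure_distr)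
  \<comment> \<open>Tightness uses intervals open on the left, so the left end is put below 0, which
    may be a code.\<close>
  have "measure (R k) {-1<..2} = 1" for k
  proof -
    have "x \<in> h -` {-1<..2}" for x using h(1)[of x] by auto
    then have "h -` {-1<..2} = UNIV" by blast
    then have "emeasure (R k) {-1<..2} = 1"
      using measure_pmf.emeasure_space_1[of "Q k"] by (subst Rem) simp_all
    then show ?thesis by (simp add: measure_def)
  qed
  then have "tight R"
    unfolding tight_def using R by (intro conjI allI impI exI[of _ "-1"] exI[of _ 2]) auto
  from tight_imp_convergent_subsubsequence[OF this, of id] obtain r P where
    r: "strict_mono r" and P: "real_distribution P" and w: "weak_conv_m (R \<circ> r) P"
    by (auto simp: strict_mono_def)
  interpret P: real_distribution P by fact
  have op: "emeasure P O' \<le> liminf (\<lambda>k. emeasure (measure_pmf (Q (r k))) (h -` O'))" if "open O'" for O'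
    using weak_conv_open[OF _ P w that] R that by (simp add: Rem)
  have Cc: "closed C" by (simp add: C_def)
  have hC: "h x \<in> C" if "x \<in> E" for x using that unfolding C_def by (intro closure_subset[THEN subsetD]) auto
  have z: "emeasure (measure_pmf (Q k)) (h -` (- C)) = 0" for k
    using Q[of k] hC by (auto simp: measure_pmf.emeasure_eq_measure measure_pmf_zero_iff disjoint_iff)
  \<comment> \<open>The complement of \<open>C\<close> is open and null for all approximating
    measures, so the bound on open sets applies to it.\<close>
  have PC: "emeasure P (- C) = 0"
    using op[of "- C"] Cc by (simp add: z Liminf_const open_Compl)
  define \<nu> where "\<nu> = distr (restrict_space P C) (restrict_space borel E) \<phi>"
  note \<nu> = distr_in_radon_measures[OF _ _ Cc PC E(1) \<phi>(1,2), folded \<nu>_def]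
  have 1: "\<nu> \<in> radon_measures E" by (rule \<nu>) (auto intro: P.finite_measure_axioms)
  have em: "emeasure \<nu> A = emeasure P (\<phi> -` A \<inter> C)" if "A \<in> sets \<nu>" for A
    by (rule \<nu>) (auto intro: P.finite_measure_axioms that)
  have sp: "space \<nu> = E" "sets \<nu> = sets (restrict_space borel E)"
    using 1 by (auto simp: radon_measures_def)
  have Eb: "E \<in> sets borel" using E by (simp add: compact_imp_closed borel_closed)
  show ?thesis
  proof (rule that[OF 1 r])
    have "emeasure \<nu> E = emeasure P (\<phi> -` E \<inter> C)"
      using sets.top[of \<nu>] sp by (intro em) auto
    also have "\<phi> -` E \<inter> C = UNIV - (- C)" using \<phi>(2) by auto
    also have "emeasure P \<dots> = emeasure P UNIV - emeasure P (- C)"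
      using Cc by (intro emeasure_Diff) (auto simp: PC open_Compl)
    also have "\<dots> = 1" using P.emeasure_space_1 by (simp add: PC)
    finally show "emeasure \<nu> E = 1" .
    fix U :: "'a set" assume U: "open U"
    have "openin (top_of_set C) (C \<inter> \<phi> -` U)"
      using \<phi>(1) U by (simp add: continuous_openin_preimage_gen)
    then obtain T where T: "open T" "C \<inter> \<phi> -` U = C \<inter> T" by (auto simp: openin_open)
    have "U \<inter> E \<in> sets \<nu>" using U Eb by (auto simp: sp sets_restrict_space_iff)
    then have "emeasure \<nu> (U \<inter> E) = emeasure P (\<phi> -` (U \<inter> E) \<inter> C)" by (rule em)
    also have "\<phi> -` (U \<inter> E) \<inter> C = C \<inter> T" using T \<phi>(2) by auto
    also have "emeasure P (C \<inter> T) \<le> emeasure P T"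
      using T by (intro emeasure_mono) auto
    also have "\<dots> \<le> liminf (\<lambda>k. emeasure (measure_pmf (Q (r k))) (h -` T))" by (rule op[OF T(1)])
    also have "(\<lambda>k. emeasure (measure_pmf (Q (r k))) (h -` T)) = (\<lambda>k. emeasure (measure_pmf (Q (r k))) U)"
    proof
      fix k
      have eq: "h x \<in> T \<longleftrightarrow> x \<in> U" if "x \<in> set_pmf (Q (r k))" for x
      proof -
        have "x \<in> E" using that Q by auto
        then have "h x \<in> C \<inter> T \<longleftrightarrow> x \<in> U" using T(2)[symmetric] hC \<phi>(3) by auto
        then show ?thesis using hC[OF \<open>x \<in> E\<close>] by auto
      qed
      show "emeasure (measure_pmf (Q (r k))) (h -` T) = emeasure (measure_pmf (Q (r k))) U"
        by (rule emeasure_eq_AE) (auto simp: AE_measure_pmf_iff eq)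
    qed
    finally show "emeasure \<nu> (U \<inter> E) \<le> liminf (\<lambda>k. emeasure (measure_pmf (Q (r k))) U)" .
  qed
qed

section \<open>Potentials on doubling spaces\<close>

text \<open>Lower semicontinuity in the centre: the ball is the increasing union of smaller
  concentric balls, each of which lies in the ball of radius \<open>r\<close> about any nearby
  centre. The hypothesis admits larger sigma-algebras, such as those of a completion or of
  \<open>measure_pmf\<close>.\<close>

lemma borel_measurable_emeasure_ball:
  fixes N :: "'a::metric_space measure"
  assumes "sets borel \<subseteq> sets N"
  shows "(\<lambda>x. emeasure N (ball x r)) \<in> borel_measurable borel"
proof (rule borel_measurableI_greater)
  fix a
  have "open {x. a < emeasure N (ball x r)}"
    unfolding open_dist
  proof (intro ballI)
    fix x assume "x \<in> {x. a < emeasure N (ball x r)}"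
    define B where "B k = ball x (r - 1 / real (Suc k))" for k
    have "incseq B"
      unfolding B_def incseq_def by (auto intro!: subset_ball diff_left_mono divide_left_mono)
    moreover have "range B \<subseteq> sets N" using assms by (auto simp: B_def)
    ultimately have "(SUP k. emeasure N (B k)) = emeasure N (\<Union>k. B k)" by (rule SUP_emeasure_incseq[rotated])
    also have "(\<Union>k. B k) = ball x r"
    proof (rule antisym; rule subsetI)
      fix y assume "y \<in> ball x r"
      then obtain k where "inverse (real (Suc k)) < r - dist x y"
        using reals_Archimedean[of "r - dist x y"] by auto
      then show "y \<in> (\<Union>k. B k)" by (auto simp: B_def inverse_eq_divide intro!: exI[of _ k])
    next
      fix y assume "y \<in> (\<Union>k. B k)"
      then obtain k where "dist x y < r - 1 / real (Suc k)" by (auto simp: B_def)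
      also have "\<dots> \<le> r" by simp
      finally show "y \<in> ball x r" by simp
    qed
    finally have "a < (SUP k. emeasure N (B k))"
      using \<open>x \<in> {x. a < emeasure N (ball x r)}\<close> by simp
    then obtain k where k: "a < emeasure N (B k)" unfolding less_SUP_iff by blast
    show "\<exists>e>0. \<forall>y. dist y x < e \<longrightarrow> y \<in> {x. a < emeasure N (ball x r)}"
    proof (intro exI[of _ "1 / real (Suc k)"] conjI allI impI CollectI)
      fix y assume y: "dist y x < 1 / real (Suc k)"
      have "B k \<subseteq> ball y r"
      proof
        fix z assume "z \<in> B k"
        then have "dist x z < r - 1 / real (Suc k)" by (simp add: B_def)
        then show "z \<in> ball y r" using y dist_triangle[of y z x] by simp
      qed
      then show "a < emeasure N (ball y r)"
        using k assms by (auto intro!: emeasure_mono less_le_trans[OF k])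
    qed auto
  qed
  then show "{x \<in> space borel. a < emeasure N (ball x r)} \<in> sets borel" by simp
qed

lemma cmult_Liminf_le:
  fixes c :: ennreal
  assumes "c < top" "a \<le> liminf u"
  shows "c * a \<le> liminf (\<lambda>k::nat. c * u k)"
proof (cases "c = 0")
  case False
  show ?thesis
    unfolding le_Liminf_iff
  proof safe
    fix y assume "y < c * a"
    then have "y / c < a" using False assms by (subst divide_less_ennreal) (auto simp: mult.commute)
    then have "\<forall>\<^sub>F k in sequentially. y / c < u k"
      using assms(2) less_LiminfD by (metis order_less_le_trans)
    then show "\<forall>\<^sub>F k in sequentially. y < c * u k"
      by eventually_elim (use False assms in \<open>auto simp: divide_less_ennreal mult.commute\<close>)
  qed
qed simp

text \<open>With exactly the Borel sigma-algebra, the measurable test sequences of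
  \<open>finite_dual\<close> are Borel, as admissibility for the capacity demands. The complete
  measure of the theorem is reduced to this case at the end.\<close>

locale doubling_borel =
  fixes M :: "'a::metric_space measure" and C :: real
  assumes sets_M: "sets M = sets borel"
    and balls: "\<And>x r. 0 < r \<Longrightarrow> 0 < emeasure M (ball x r) \<and> emeasure M (ball x r) < top"
    and doubling: "\<And>x r. 0 < r \<Longrightarrow> emeasure M (ball x (2 * r)) \<le> ennreal C * emeasure M (ball x r)"
begin

lemma space_M: "space M = UNIV"
  using sets_eq_imp_space_eq[OF sets_M] by simp

lemma measurable_M: "borel_measurable M = borel_measurable borel"
  using sets_M by (rule measurable_cong_sets) simp

lemma sigma_finite: "sigma_finite_measure M"
proof
  obtain x :: 'a where True by simp
  have "\<exists>n::nat. dist x y < real n" for y by (rule reals_Archimedean2)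
  then have "(\<Union>n::nat. ball x (real n)) = UNIV" by auto
  moreover have "emeasure M (ball x (real n)) \<noteq> \<infinity>" for n
    using balls[of "real n" x] by (cases "n = 0") auto
  ultimately show "\<exists>A. countable A \<and> A \<subseteq> sets M \<and> \<Union>A = space M \<and> (\<forall>a\<in>A. emeasure M a \<noteq> \<infinity>)"
    by (intro exI[of _ "range (\<lambda>n::nat. ball x (real n))"]) (auto simp: sets_M space_M)
qed

lemma measurable_dual_pot:
  assumes "sets borel \<subseteq> sets N"
  shows "dual_pot M \<beta> N n \<in> borel_measurable M"
proof -
  have [measurable]: "(\<lambda>x. emeasure N (ball x r)) \<in> borel_measurable M"
    "(\<lambda>x. emeasure M (ball x r)) \<in> borel_measurable M" for r
    using borel_measurable_emeasure_ball[OF assms] borel_measurable_emeasure_ball[of M]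
    by (simp_all add: sets_M measurable_M)
  show ?thesis unfolding dual_pot_def[abs_def] by measurable
qed

text \<open>Without countability, an open subset of a product need not belong to the product
  sigma-algebra. Compactness of \<open>E\<close> supplies countability: finite nets of all levels
  exhibit the set as a countable union of rectangles.\<close>

lemma measurable_near:
  assumes E: "compact E" and N: "sets N = sets (restrict_space borel E)"
  shows "{(x, y) \<in> space N \<times> UNIV. dist y x < r} \<in> sets (N \<Otimes>\<^sub>M M)"
proof -
  have spN: "space N = E" using sets_eq_imp_space_eq[OF N] by (simp add: space_restrict_space)
  have Eb: "E \<in> sets borel" using E by (simp add: compact_imp_closed borel_closed)
  obtain F where F: "\<And>m. finite (F m)" "\<And>m. E \<subseteq> (\<Union>x\<in>F m. ball x (1 / real (Suc m)))"
    using compact_finite_nets[OF E] by blast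
  have eq: "{(x, y) \<in> space N \<times> UNIV. dist y x < r}
     = (\<Union>m. \<Union>z\<in>F m. (ball z (1 / real (Suc m)) \<inter> E) \<times> ball z (r - 1 / real (Suc m)))" (is "?L = ?R")
  proof (rule antisym; rule subsetI)
    fix xy assume "xy \<in> ?L"
    then obtain x y where xy: "xy = (x, y)" "x \<in> E" "dist y x < r" by (auto simp: spN)
    \<comment> \<open>Half of the slack, since the net error is paid twice: in the distance from
      \<open>z\<close> to \<open>x\<close> and in the reduced radius of the second ball.\<close>
    then obtain m where m: "inverse (real (Suc m)) < (r - dist y x) / 2"
      using reals_Archimedean[of "(r - dist y x) / 2"] by auto
    obtain z where z: "z \<in> F m" "dist z x < 1 / real (Suc m)" using F(2)[of m] xy(2) by auto
    have "dist z y < r - 1 / real (Suc m)"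
      using m z dist_triangle[of z y x] by (simp add: inverse_eq_divide dist_commute)
    then show "xy \<in> ?R" using z xy by (auto intro!: exI[of _ m] bexI[of _ z])
  next
    fix xy assume "xy \<in> ?R"
    then obtain m z where "z \<in> F m" "dist z (fst xy) < 1 / real (Suc m)" "fst xy \<in> E"
      "dist z (snd xy) < r - 1 / real (Suc m)" by auto
    then show "xy \<in> ?L" using dist_triangle3[of "snd xy" "fst xy" z]
      by (auto simp: spN case_prod_beta mem_Times_iff)
  qed
  have "(ball z a \<inter> E) \<times> ball z b \<in> sets (N \<Otimes>\<^sub>M M)" for z a b
    using Eb by (intro pair_measureI) (auto simp: N sets_M sets_restrict_space_iff)
  then have "?R \<in> sets (N \<Otimes>\<^sub>M M)"
    by (intro sets.countable_UN sets.finite_UN F(1) image_subsetI)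
  then show ?thesis using eq by simp
qed

section \<open>The inequality between an arbitrary admissible sequence and an arbitrary
  measure\<close>

lemma duality_le:
  assumes E: "compact E" and \<nu>: "\<nu> \<in> radon_measures E" and p: "1 < p" and q: "1 \<le> q"
    and f: "\<And>n. n \<in> scales TYPE('a) \<Longrightarrow> f n \<in> borel_measurable borel"
    and adm: "\<And>x. x \<in> E \<Longrightarrow> 1 \<le> pot M \<beta> f x"
  shows "emeasure \<nu> E \<le> mixed_norm M p q f *
    mixed_norm M (p / (p - 1)) (conj_exponent q) (dual_pot M \<beta> (zero_extension \<nu>))"
proof -
  let ?I = "scales TYPE('a)"
  let ?r = "\<lambda>n. 2 powi (- n) :: real"
  have sp: "space \<nu> = E" and st: "sets \<nu> = sets (restrict_space borel E)" and fin: "emeasure \<nu> E < top"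
    using \<nu> by (auto simp: radon_measures_def)
  interpret M: sigma_finite_measure M by (rule sigma_finite)
  interpret \<nu>: finite_measure \<nu> by standard (use sp fin in auto)
  interpret P: pair_sigma_finite \<nu> M ..
  let ?k = "\<lambda>n x y. indicator (ball y (?r n)) x / emeasure M (ball y (?r n)) * f n y"
  have bm [measurable]: "(\<lambda>y. emeasure M (ball y r)) \<in> borel_measurable M" for r
    using borel_measurable_emeasure_ball[of M] by (simp add: sets_M measurable_M)
  have km: "(\<lambda>(x, y). ?k n x y) \<in> borel_measurable (\<nu> \<Otimes>\<^sub>M M)" if n: "n \<in> ?I" for n
  proof -
    have [measurable]: "f n \<in> borel_measurable M" using f[OF n] by (simp add: measurable_M)
    have "(\<lambda>xy. indicator {(x, y) \<in> space \<nu> \<times> UNIV. dist y x < ?r n} xy / emeasure M (ball (snd xy) (?r n)) * f n (snd xy))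
       \<in> borel_measurable (\<nu> \<Otimes>\<^sub>M M)"
      using measurable_near[OF E st, of "?r n"] by measurable
    then show ?thesis
      by (rule measurable_cong[THEN iffD1, rotated])
        (auto simp: space_pair_measure indicator_def)
  qed
  have km1: "(\<lambda>x. \<integral>\<^sup>+y. ?k n x y \<partial>M) \<in> borel_measurable \<nu>" if "n \<in> ?I" for n
    using M.borel_measurable_nn_integral[OF km[OF that]] by simp
  \<comment> \<open>Integrating in \<open>x\<close> first replaces the indicator by the mass of the
    ball centred at \<open>y\<close>, as in the dual potential.\<close>
  have swap: "(\<integral>\<^sup>+x. \<integral>\<^sup>+y. ?k n x y \<partial>M \<partial>\<nu>) = (\<integral>\<^sup>+y. (emeasure (zero_extension \<nu>) (ball y (?r n)) / emeasure M (ball y (?r n))) * f n y \<partial>M)"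
    if n: "n \<in> ?I" for n
  proof -
    have "(\<integral>\<^sup>+x. \<integral>\<^sup>+y. ?k n x y \<partial>M \<partial>\<nu>) = (\<integral>\<^sup>+y. \<integral>\<^sup>+x. ?k n x y \<partial>\<nu> \<partial>M)"
      using P.Fubini'[OF km[OF n]] by simp
    also have "\<dots> = (\<integral>\<^sup>+y. (emeasure (zero_extension \<nu>) (ball y (?r n)) / emeasure M (ball y (?r n))) * f n y \<partial>M)"
    proof (rule nn_integral_cong)
      fix y
      have b: "ball y (?r n) \<inter> E \<in> sets \<nu>"
        using E by (auto simp: st sets_restrict_space_iff compact_imp_closed borel_closed)
      have "(\<integral>\<^sup>+x. ?k n x y \<partial>\<nu>) = (\<integral>\<^sup>+x. (f n y / emeasure M (ball y (?r n))) * indicator (ball y (?r n) \<inter> E) x \<partial>\<nu>)"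
        by (intro nn_integral_cong) (auto simp: indicator_def sp divide_ennreal_def mult.commute)
      also have "\<dots> = (f n y / emeasure M (ball y (?r n))) * emeasure \<nu> (ball y (?r n) \<inter> E)"
        using b by (rule nn_integral_cmult_indicator)
      also have "\<dots> = emeasure (zero_extension \<nu>) (ball y (?r n)) / emeasure M (ball y (?r n)) * f n y"
        by (simp add: emeasure_zero_extension[OF \<nu>] divide_ennreal_def mult_ac)
      finally show "(\<integral>\<^sup>+x. ?k n x y \<partial>\<nu>) = \<dots>" .
    qed
    finally show ?thesis .
  qed
  have dm: "dual_pot M \<beta> (zero_extension \<nu>) n \<in> borel_measurable M" for n
    by (rule measurable_dual_pot) (simp add: zero_extension_def)
  have fM: "f n \<in> borel_measurable M" if "n \<in> ?I" for n using f[OF that] by (simp add: measurable_M)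
  have "emeasure \<nu> E = (\<integral>\<^sup>+x. 1 \<partial>\<nu>)" by (simp add: sp)
  also have "\<dots> \<le> (\<integral>\<^sup>+x. pot M \<beta> f x \<partial>\<nu>)"
    using adm sp by (intro nn_integral_mono) auto
  also have "\<dots> = (\<integral>\<^sup>+n. \<integral>\<^sup>+x. ennreal (2 powr (- \<beta> * real_of_int n)) * (\<integral>\<^sup>+y. ?k n x y \<partial>M) \<partial>\<nu> \<partial>count_space ?I)"
    unfolding pot_def using km1 by (intro nn_integral_count_space_nn_integral) auto
  also have "\<dots> = (\<integral>\<^sup>+n. \<integral>\<^sup>+y. f n y * dual_pot M \<beta> (zero_extension \<nu>) n y \<partial>M \<partial>count_space ?I)"
  proof (rule nn_integral_cong)
    fix n assume "n \<in> space (count_space ?I)"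
    then have n: "n \<in> ?I" by simp
    have [measurable]: "f n \<in> borel_measurable M" by (rule fM[OF n])
    have zm [measurable]: "(\<lambda>y. emeasure (zero_extension \<nu>) (ball y r)) \<in> borel_measurable M" for r
      using borel_measurable_emeasure_ball[of "zero_extension \<nu>"] by (simp add: zero_extension_def measurable_M)
    have "(\<integral>\<^sup>+x. ennreal (2 powr (- \<beta> * real_of_int n)) * (\<integral>\<^sup>+y. ?k n x y \<partial>M) \<partial>\<nu>)
        = ennreal (2 powr (- \<beta> * real_of_int n)) * (\<integral>\<^sup>+x. \<integral>\<^sup>+y. ?k n x y \<partial>M \<partial>\<nu>)"
      by (intro nn_integral_cmult km1 n)
    also have "\<dots> = (\<integral>\<^sup>+y. ennreal (2 powr (- \<beta> * real_of_int n)) *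
        ((emeasure (zero_extension \<nu>) (ball y (?r n)) / emeasure M (ball y (?r n))) * f n y) \<partial>M)"
      unfolding swap[OF n] by (intro nn_integral_cmult[symmetric]) measurable
    also have "\<dots> = (\<integral>\<^sup>+y. f n y * dual_pot M \<beta> (zero_extension \<nu>) n y \<partial>M)"
      by (simp add: dual_pot_def mult_ac)
    finally show "(\<integral>\<^sup>+x. ennreal (2 powr (- \<beta> * real_of_int n)) * (\<integral>\<^sup>+y. ?k n x y \<partial>M) \<partial>\<nu>) = \<dots>" .
  qed
  also have "\<dots> = (\<integral>\<^sup>+y. \<integral>\<^sup>+n. f n y * dual_pot M \<beta> (zero_extension \<nu>) n y \<partial>count_space ?I \<partial>M)"
    using fM dm by (intro nn_integral_count_space_nn_integral[symmetric]) auto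
  also have "\<dots> \<le> mixed_norm M p q f * mixed_norm M (p / (p - 1)) (conj_exponent q) (dual_pot M \<beta> (zero_extension \<nu>))"
    by (intro mixed_norm_Hoelder p q fM dm)
  finally show ?thesis .
qed

text \<open>The ball about \<open>x\<close> lies in the doubled ball about \<open>y\<close>.
  Doubling thus bounds the kernel near a fixed net point uniformly in the centre
  \<open>y\<close>.\<close>

lemma inverse_ball_le:
  assumes "0 < r" "dist x y < r"
  shows "inverse (emeasure M (ball y r)) \<le> ennreal C * inverse (emeasure M (ball x r))"
proof -
  define a b where "a = emeasure M (ball x r)" and "b = emeasure M (ball y r)"
  have ab: "0 < a" "a < top" "0 < b" "b < top" using balls assms(1) by (auto simp: a_def b_def)
  have "a \<le> emeasure M (ball y (2 * r))"
    unfolding a_def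
  proof (rule emeasure_mono)
    show "ball x r \<subseteq> ball y (2 * r)"
    proof
      fix z assume "z \<in> ball x r"
      then show "z \<in> ball y (2 * r)" using assms(2) dist_triangle[of y z x] by (simp add: dist_commute)
    qed
  qed (simp add: sets_M)
  also have "\<dots> \<le> ennreal C * b" unfolding b_def by (rule doubling[OF assms(1)])
  finally have "a * (inverse a * inverse b) \<le> ennreal C * b * (inverse a * inverse b)" by (rule mult_right_mono) simp
  moreover have "a * inverse a = 1" "b * inverse b = 1" using ab by (auto intro!: ennreal_mult_inverse)
  then have "a * (inverse a * inverse b) = inverse b" "ennreal C * b * (inverse a * inverse b) = ennreal C * inverse a"
    by (metis mult.assoc mult_1, metis mult.assoc mult.commute mult_1)
  ultimately show ?thesis by (simp add: a_def b_def)
qed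

lemma discrete_dual:
  assumes E: "compact E" "E \<noteq> {}" and p: "1 < p" and q: "1 \<le> q"
    and J: "finite J" "J \<subseteq> scales TYPE('a)" and s: "0 < s" "s < 1"
    and t: "0 < t" "ennreal t < ennpow (potential_cap M \<beta> p q E) (1 / p)"
  shows "\<exists>Q. set_pmf Q \<subseteq> E \<and> mixed_norm M (p / (p - 1)) (conj_exponent q)
    (\<lambda>n x. indicator J n * (ennreal (2 powr (- \<beta> * real_of_int n)) *
       (emeasure (measure_pmf Q) (ball x (s * 2 powi (- n))) / emeasure M (ball x (2 powi (- n)))))) \<le> ennreal (1 / t)"
proof -
  let ?I = "scales TYPE('a)"
  let ?r = "\<lambda>n. 2 powi (- n) :: real"
  let ?w = "\<lambda>n. ennreal (2 powr (- \<beta> * real_of_int n))"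
  \<comment> \<open>The denominator keeps the full ball, so comparing this kernel with that of the
    potential is a matter of indicators alone.\<close>
  define K where "K i n y = indicator J n * (?w n * (indicator (ball y (s * ?r n)) i / emeasure M (ball y (?r n))))"
    for i n y
  \<comment> \<open>For \<open>dist i x < \<delta>\<close> and every retained scale,
    \<open>dist y i < s * ?r n\<close> implies \<open>dist y x < ?r n\<close>. The element 1 keeps
    the minimum meaningful for empty \<open>J\<close>.\<close>
  define \<delta> where "\<delta> = Min (insert 1 ((\<lambda>n. (1 - s) * ?r n) ` J))"
  have "0 < \<delta>" using J s by (auto simp: \<delta>_def)
  have \<delta>: "\<delta> \<le> (1 - s) * ?r n" if "n \<in> J" for n
    unfolding \<delta>_def using J that by (intro Min_le) auto
  \<comment> \<open>The net is taken inside \<open>E\<close>, so that the measure found on it is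
    supported in \<open>E\<close>.\<close>
  have "\<exists>k. finite k \<and> k \<subseteq> E \<and> E \<subseteq> (\<Union>x\<in>k. ball x \<delta>)"
    by (rule seq_compact_imp_totally_bounded[OF compact_imp_seq_compact[OF E(1)], rule_format, OF \<open>0 < \<delta>\<close>])
  then obtain F where F: "finite F" "F \<subseteq> E" "E \<subseteq> (\<Union>x\<in>F. ball x \<delta>)" by auto
  have F0: "F \<noteq> {}" using F E by auto
  have bm [measurable]: "(\<lambda>y. emeasure M (ball y r)) \<in> borel_measurable M" for r
    using borel_measurable_emeasure_ball[of M] by (simp add: sets_M measurable_M)
  have Km: "K i n \<in> borel_measurable M" for i n
  proof -
    have "indicator (ball y (s * ?r n)) i = (indicator (ball i (s * ?r n)) y :: ennreal)" for y
      by (auto simp: indicator_def dist_commute)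
    moreover have [measurable]: "ball i (s * ?r n) \<in> sets M" by (simp add: sets_M)
    ultimately show ?thesis unfolding K_def[abs_def] by simp
  qed
  define A where "A = (\<Union>i\<in>F. \<Union>n\<in>J. ball i (?r n))"
  have A: "A \<in> sets M" unfolding A_def using F J by (auto simp: sets_M)
  have Afin: "emeasure M A < top"
  proof -
    have "emeasure M A \<le> (\<Sum>i\<in>F. emeasure M (\<Union>n\<in>J. ball i (?r n)))"
      unfolding A_def using F J by (intro emeasure_subadditive_finite) (auto simp: sets_M)
    also have "\<dots> \<le> (\<Sum>i\<in>F. \<Sum>n\<in>J. emeasure M (ball i (?r n)))"
      using J by (intro sum_mono emeasure_subadditive_finite) (auto simp: sets_M)
    also have "\<dots> < top" using F J balls by (auto simp: less_top[symmetric])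
    finally show ?thesis .
  qed
  define b where "b i n = ?w n * (ennreal C * inverse (emeasure M (ball i (?r n))))" for i n
  have bfin: "b i n < top" for i n
    using balls[of "?r n" i] by (auto simp: b_def ennreal_mult_less_top less_top[symmetric] ennreal_inverse_eq_top_iff ennreal_mult_eq_top_iff)
  define c where "c = (\<Sum>i\<in>F. \<Sum>n\<in>J. enn2real (b i n))"
  have bc: "b i n \<le> ennreal c" if "i \<in> F" "n \<in> J" for i n
  proof -
    have "enn2real (b i n) \<le> (\<Sum>n\<in>J. enn2real (b i n))"
      using J that by (intro member_le_sum) auto
    also have "\<dots> \<le> c" unfolding c_def using F that by (intro member_le_sum[of i F "\<lambda>i. \<Sum>n\<in>J. enn2real (b i n)"]) (auto intro: sum_nonneg)
    finally have "ennreal (enn2real (b i n)) \<le> ennreal c" by (rule ennreal_leI)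
    then show ?thesis using bfin by simp
  qed
  have Kb: "K i n y \<le> ennreal c * indicator J n * indicator A y" if i: "i \<in> F" for i n y
  proof (cases "n \<in> J \<and> dist i y < s * ?r n")
    case True
    then have lt: "dist i y < ?r n" using s by (smt (verit) mult_less_cancel_right2 zero_less_power_int)
    then have "y \<in> A" using True i by (auto simp: A_def)
    moreover have "K i n y \<le> b i n"
      using True inverse_ball_le[OF _ lt] by (auto simp: K_def b_def dist_commute divide_ennreal_def intro!: mult_left_mono)
    ultimately show ?thesis using True bc[OF i, of n] by simp
  next
    case False
    then have "K i n y = 0" by (auto simp: K_def indicator_def dist_commute)
    then show ?thesis by simp
  qed
  have adm: "ennreal t \<le> mixed_norm M p q f"
    if f: "\<And>n. n \<in> ?I \<Longrightarrow> f n \<in> borel_measurable M" and one: "\<And>i. i \<in> F \<Longrightarrow> 1 \<le> pairing M f (K i)" for f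
  proof -
    have "1 \<le> pot M \<beta> f x" if x: "x \<in> E" for x
    proof -
      obtain i where i: "i \<in> F" "dist i x < \<delta>" using F x by auto
      have le: "f n y * K i n y \<le> ?w n * (indicator (ball y (?r n)) x / emeasure M (ball y (?r n)) * f n y)" for n y
      proof (cases "n \<in> J \<and> dist y i < s * ?r n")
        case True
        then have "dist y x < s * ?r n + (1 - s) * ?r n"
          using i(2) \<delta>[of n] dist_triangle[of y x i] by linarith
        then have "dist y x < ?r n" by (simp add: algebra_simps)
        then show ?thesis using True by (simp add: K_def mult_ac)
      next
        case False
        then have "K i n y = 0" by (auto simp: K_def indicator_def)
        then show ?thesis by simp
      qed
      have "1 \<le> pairing M f (K i)" by (rule one[OF i(1)])
      also have "\<dots> = (\<integral>\<^sup>+n. \<integral>\<^sup>+y. f n y * K i n y \<partial>M \<partial>count_space ?I)"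
        unfolding pairing_def using f Km by (intro nn_integral_count_space_nn_integral) auto
      also have "\<dots> \<le> pot M \<beta> f x"
        unfolding pot_def
      proof (rule nn_integral_mono)
        fix n assume "n \<in> space (count_space ?I)"
        then have [measurable]: "f n \<in> borel_measurable M" using f by auto
        have "indicator (ball y (?r n)) x = (indicator (ball x (?r n)) y :: ennreal)" for y
          by (auto simp: indicator_def dist_commute)
        moreover have [measurable]: "ball x (?r n) \<in> sets M" by (simp add: sets_M)
        ultimately have "(\<lambda>y. indicator (ball y (?r n)) x / emeasure M (ball y (?r n)) * f n y) \<in> borel_measurable M"
          by simp
        then have "?w n * (\<integral>\<^sup>+y. indicator (ball y (?r n)) x / emeasure M (ball y (?r n)) * f n y \<partial>M)
           = (\<integral>\<^sup>+y. ?w n * (indicator (ball y (?r n)) x / emeasure M (ball y (?r n)) * f n y) \<partial>M)"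
          by (rule nn_integral_cmult[symmetric])
        then show "(\<integral>\<^sup>+y. f n y * K i n y \<partial>M) \<le> ?w n * (\<integral>\<^sup>+y. indicator (ball y (?r n)) x / emeasure M (ball y (?r n)) * f n y \<partial>M)"
          using le by (auto intro!: nn_integral_mono)
      qed
      finally show ?thesis .
    qed
    then have "potential_cap M \<beta> p q E \<le> ennpow (mixed_norm M p q f) p"
      unfolding potential_cap_def using f by (intro INF_lower) (auto simp: measurable_M)
    then have "ennpow (potential_cap M \<beta> p q E) (1 / p) \<le> ennpow (ennpow (mixed_norm M p q f) p) (1 / p)"
      using p by (intro ennpow_mono) auto
    then show ?thesis using t(2) p by (simp add: ennpow_inverse)
  qed
  obtain Q where Q: "set_pmf Q \<subseteq> F"
    "mixed_norm M (p / (p - 1)) (conj_exponent q) (\<lambda>n x. \<Sum>i\<in>F. ennreal (pmf Q i) * K i n x) \<le> ennreal (1 / t)"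
    by (rule finite_dual[OF p q J F(1) F0 A Afin, where K = K and c = c and t = t]) (use Km Kb adm t(1) in auto)
  have "(\<Sum>i\<in>F. ennreal (pmf Q i) * K i n x) = indicator J n * (?w n *
       (emeasure (measure_pmf Q) (ball x (s * ?r n)) / emeasure M (ball x (?r n))))" for n x
  proof -
    have "emeasure (measure_pmf Q) (ball x (s * ?r n)) = (\<integral>\<^sup>+i. indicator (ball x (s * ?r n)) i \<partial>measure_pmf Q)"
      by simp
    also have "\<dots> = (\<Sum>i\<in>F. ennreal (pmf Q i) * indicator (ball x (s * ?r n)) i)"
      using Q(1) F(1) by (subst nn_integral_measure_pmf_support[of F]) (auto simp: mult.commute set_pmf_iff)
    finally show ?thesis
      by (simp add: K_def sum_distrib_left sum_distrib_right divide_ennreal_def mult_ac)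
  qed
  then show ?thesis using Q F(2) by (intro exI[of _ Q]) auto
qed

lemma extremal_measure:
  assumes E: "compact E" "E \<noteq> {}" and p: "1 < p" and q: "1 \<le> q"
    and t: "0 < t" "ennreal t < ennpow (potential_cap M \<beta> p q E) (1 / p)"
  obtains \<nu> where "\<nu> \<in> radon_measures E" "emeasure \<nu> E = 1"
    "mixed_norm M (p / (p - 1)) (conj_exponent q) (dual_pot M \<beta> (zero_extension \<nu>)) \<le> ennreal (1 / t)"
proof -
  let ?I = "scales TYPE('a)"
  let ?r = "\<lambda>n. 2 powi (- n) :: real"
  let ?w = "\<lambda>n. ennreal (2 powr (- \<beta> * real_of_int n))"
  \<comment> \<open>Increasing to 1 and equal to 1/2 at \<open>j = 0\<close>, hence always strictly
    between 0 and 1.\<close>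
  define s where "s j = 1 - 1 / real (j + 2)" for j
  define J where "J j = ?I \<inter> {- int j..int j}" for j
  have s: "0 < s j" "s j < 1" for j by (auto simp: s_def field_simps)
  have sm: "s i \<le> s j" if "i \<le> j" for i j using that by (auto simp: s_def intro!: diff_left_mono divide_left_mono)
  have "\<exists>Q. set_pmf Q \<subseteq> E \<and> mixed_norm M (p / (p - 1)) (conj_exponent q)
    (\<lambda>n x. indicator (J j) n * (?w n * (emeasure (measure_pmf Q) (ball x (s j * ?r n)) / emeasure M (ball x (?r n))))) \<le> ennreal (1 / t)" for j
    by (rule discrete_dual[OF E p q _ _ s t]) (auto simp: J_def)
  then have "\<forall>j. \<exists>Q. set_pmf Q \<subseteq> E \<and> mixed_norm M (p / (p - 1)) (conj_exponent q)
    (\<lambda>n x. indicator (J j) n * (?w n * (emeasure (measure_pmf Q) (ball x (s j * ?r n)) / emeasure M (ball x (?r n))))) \<le> ennreal (1 / t)"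
    by (rule allI)
  from choice[OF this] obtain Q where Q: "\<And>j. set_pmf (Q j) \<subseteq> E" "\<And>j. mixed_norm M (p / (p - 1)) (conj_exponent q)
    (\<lambda>n x. indicator (J j) n * (?w n * (emeasure (measure_pmf (Q j)) (ball x (s j * ?r n)) / emeasure M (ball x (?r n))))) \<le> ennreal (1 / t)"
    by (elim exE) auto
  obtain \<nu> and \<rho> :: "nat \<Rightarrow> nat" where \<nu>: "\<nu> \<in> radon_measures E" "strict_mono \<rho>" "emeasure \<nu> E = 1"
    "\<And>U. open U \<Longrightarrow> emeasure \<nu> (U \<inter> E) \<le> liminf (\<lambda>k. emeasure (measure_pmf (Q (\<rho> k))) U)"
    by (rule weak_limit_pmf[where Q = Q, OF E Q(1)]) blast
  let ?N = "zero_extension \<nu>"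
  have Nb: "sets borel \<subseteq> sets ?N" by (simp add: zero_extension_def)
  define g where "g k n x = indicator (J (\<rho> k)) n * (?w n *
      (emeasure (measure_pmf (Q (\<rho> k))) (ball x (s (\<rho> k) * ?r n)) / emeasure M (ball x (?r n))))" for k n x
  have "mixed_norm M (p / (p - 1)) (conj_exponent q) (dual_pot M \<beta> ?N) \<le> ennreal (1 / t)"
  proof (rule mixed_norm_Fatou[where g = g])
    show "0 < p / (p - 1)" using p by simp
    show "1 \<le> conj_exponent q" by (rule conj_exponent_ge_1[OF q])
    show "mixed_norm M (p / (p - 1)) (conj_exponent q) (g k) \<le> ennreal (1 / t)" for k
      unfolding g_def[abs_def] by (rule Q(2))
    show "g k n \<in> borel_measurable M" for k n
      using borel_measurable_emeasure_ball[of M] borel_measurable_emeasure_ball[of "measure_pmf (Q (\<rho> k))"]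
      unfolding g_def[abs_def] by (simp add: sets_M measurable_M)
    fix n x assume n: "n \<in> ?I"
    define u where "u k = indicator (J (\<rho> k)) n * emeasure (measure_pmf (Q (\<rho> k))) (ball x (s (\<rho> k) * ?r n))" for k
    \<comment> \<open>The weak limit is tested on a ball with fixed ratio \<open>s i\<close>,
      because the balls in the approximating bounds vary with \<open>k\<close>; these contain
      \<open>B i\<close> once \<open>\<rho> k \<ge> i\<close>. Only afterwards does \<open>i\<close>
      tend to infinity.\<close>
    define B where "B i = ball x (s i * ?r n)" for i
    have "emeasure ?N (B i) \<le> liminf u" for i
    proof -
      have "emeasure ?N (B i) = emeasure \<nu> (B i \<inter> E)"
        by (simp add: B_def emeasure_zero_extension[OF \<nu>(1)])
      also have "\<dots> \<le> liminf (\<lambda>k. emeasure (measure_pmf (Q (\<rho> k))) (B i))"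
        by (rule \<nu>(4)) (simp add: B_def)
      also have "\<dots> \<le> liminf u"
      proof (rule Liminf_mono)
        show "\<forall>\<^sub>F k in sequentially. emeasure (measure_pmf (Q (\<rho> k))) (B i) \<le> u k"
          \<comment> \<open>From this stage on the ratio is at least \<open>s i\<close> and the
            scale \<open>n\<close> is among the retained ones.\<close>
          using eventually_ge_at_top[of "max i (nat \<bar>n\<bar>)"]
        proof eventually_elim
          case (elim k)
          then have k: "max i (nat \<bar>n\<bar>) \<le> \<rho> k" using seq_suble[OF \<nu>(2), of k] by simp
          then have "n \<in> J (\<rho> k)" using n by (auto simp: J_def)
          moreover have "B i \<subseteq> ball x (s (\<rho> k) * ?r n)"
            unfolding B_def using sm[of i "\<rho> k"] k by (intro subset_ball mult_right_mono) auto
          ultimately show ?case by (auto simp: u_def intro!: emeasure_mono)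
        qed
      qed
      finally show ?thesis .
    qed
    then have "(SUP i. emeasure ?N (B i)) \<le> liminf u" by (rule SUP_least)
    also have "(SUP i. emeasure ?N (B i)) = emeasure ?N (\<Union>i. B i)"
      by (rule SUP_emeasure_incseq)
        (use Nb sm in \<open>auto simp: B_def incseq_def intro!: subset_ball mult_right_mono\<close>)
    also have "(\<Union>i. B i) = ball x (?r n)"
    proof (rule antisym; rule subsetI)
      fix y assume "y \<in> (\<Union>i. B i)"
      then obtain i where "dist x y < s i * ?r n" by (auto simp: B_def)
      also have "\<dots> \<le> 1 * ?r n" using s[of i] by (intro mult_right_mono) auto
      finally show "y \<in> ball x (?r n)" by simp
    next
      fix y assume "y \<in> ball x (?r n)"
      then have "0 < 1 - dist x y / ?r n" by (simp add: field_simps)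
      then obtain i where "inverse (real (Suc i)) < 1 - dist x y / ?r n" using reals_Archimedean by blast
      moreover have "1 / real (i + 2) \<le> inverse (real (Suc i))" by (simp add: field_simps)
      ultimately have "dist x y / ?r n < s i" by (simp add: s_def)
      then have "dist x y < s i * ?r n" by (simp add: pos_divide_less_eq)
      then show "y \<in> (\<Union>i. B i)" by (auto simp: B_def)
    qed
    finally have le: "emeasure ?N (ball x (?r n)) \<le> liminf u" .
    have c: "?w n * inverse (emeasure M (ball x (?r n))) < top"
      using balls[of "?r n" x] by (auto simp: less_top[symmetric] ennreal_mult_eq_top_iff ennreal_inverse_eq_top_iff)
    show "dual_pot M \<beta> ?N n x \<le> liminf (\<lambda>k. g k n x)"
      using cmult_Liminf_le[OF c le] by (simp add: dual_pot_def g_def u_def divide_ennreal_def mult_ac)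
  qed
  then show ?thesis using that \<nu> by blast
qed

lemma potential_cap_dual:
  assumes E: "compact E" and p: "1 < p" and q: "1 \<le> q"
  shows "ennpow (potential_cap M \<beta> p q E) (1 / p) =
    (SUP \<nu> \<in> radon_measures E.
       emeasure \<nu> E / mixed_norm M (p / (p - 1)) (conj_exponent q) (dual_pot M \<beta> (zero_extension \<nu>)))"
    (is "?cap = ?sup")
proof (rule antisym)
  show "?cap \<le> ?sup"
  proof (rule dense_le)
    \<comment> \<open>Values strictly below the capacity are finite, so infinite capacity is covered
      as well.\<close>
    fix y assume y: "y < ?cap"
    then obtain t where t: "y = ennreal t" "0 \<le> t" by (cases y) auto
    show "y \<le> ?sup"
    proof (cases "t = 0")
      case False
      then have t0: "0 < t" using t by simp
      \<comment> \<open>For empty \<open>E\<close> the zero sequence is admissible and the capacity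
        is 0, leaving no room for \<open>t > 0\<close>.\<close>
      have "E \<noteq> {}"
      proof
        assume "E = {}"
        then have "potential_cap M \<beta> p q E \<le> ennpow (mixed_norm M p q (\<lambda>_ _. 0)) p"
          unfolding potential_cap_def by (intro INF_lower) auto
        also have "\<dots> = 0"
          using p q by (subst mixed_norm_cmult[of p q "\<lambda>_ _. 0" M 0, simplified]) auto
        finally show False using y by simp
      qed
      then obtain \<nu> where \<nu>: "\<nu> \<in> radon_measures E" "emeasure \<nu> E = 1"
        "mixed_norm M (p / (p - 1)) (conj_exponent q) (dual_pot M \<beta> (zero_extension \<nu>)) \<le> ennreal (1 / t)" (is "?m \<le> _")
        using extremal_measure[OF E _ p q t0] y t by blast
      \<comment> \<open>If the norm is 0, the quotient \<open>1 / 0\<close> is infinite in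
        \<open>ennreal\<close>.\<close>
      have "ennreal t \<le> 1 / ?m"
      proof (cases "?m = 0")
        case False
        moreover obtain m where m: "?m = ennreal m" "0 \<le> m" using \<nu>(3) by (cases ?m) (auto simp: top_unique)
        ultimately have "0 < m" "m \<le> 1 / t" using \<nu>(3) t0 by (auto simp: less_le)
        then have "t \<le> 1 / m" using t0 by (simp add: field_simps)
        then show ?thesis using \<open>0 < m\<close> unfolding m
          by (simp add: divide_ennreal[of 1 m, simplified] ennreal_leI)
      qed simp
      then have "y \<le> emeasure \<nu> E / ?m" by (simp add: t \<nu>(2))
      also have "\<dots> \<le> ?sup" by (rule SUP_upper[OF \<nu>(1)])
      finally show ?thesis .
    qed (simp add: t)
  qed
  show "?sup \<le> ?cap"
  proof (rule SUP_least)
    fix \<nu> assume \<nu>: "\<nu> \<in> radon_measures E"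
    let ?m = "mixed_norm M (p / (p - 1)) (conj_exponent q) (dual_pot M \<beta> (zero_extension \<nu>))"
    have "ennpow (emeasure \<nu> E / ?m) p \<le> potential_cap M \<beta> p q E"
      unfolding potential_cap_def
    proof (rule INF_greatest)
      fix f assume "f \<in> {f. (\<forall>n\<in>scales TYPE('a). f n \<in> borel_measurable borel) \<and> (\<forall>x\<in>E. 1 \<le> pot M \<beta> f x)}"
      then have "emeasure \<nu> E \<le> mixed_norm M p q f * ?m" by (intro duality_le E \<nu> p q) auto
      \<comment> \<open>If \<open>?m = 0\<close>, the preceding bound forces mass 0, even for
        \<open>f\<close> of infinite norm, and the quotient is \<open>0 / 0 = 0\<close>.\<close>
      then have "emeasure \<nu> E / ?m \<le> mixed_norm M p q f"
        by (cases "?m = 0") (auto intro: divide_le_posI_ennreal simp: mult.commute zero_less_iff_neq_zero)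
      then show "ennpow (emeasure \<nu> E / ?m) p \<le> ennpow (mixed_norm M p q f) p"
        using p by (intro ennpow_mono) auto
    qed
    then have "ennpow (ennpow (emeasure \<nu> E / ?m) p) (1 / p) \<le> ?cap"
      using p by (intro ennpow_mono) auto
    then show "emeasure \<nu> E / ?m \<le> ?cap" using p by (simp add: ennpow_inverse)
  qed
qed

end

theorem theorem7p3:
  fixes M :: "'a::metric_space measure"
    and c\<^sub>\<mu> p \<beta> :: real and q :: ennreal and E :: "'a set"
  assumes two_points: "\<exists>x y :: 'a. x \<noteq> y"
    and complete: "complete_measure M"
    and borel: "sets borel \<subseteq> sets M"
    and balls: "\<And>(x::'a) r. r > 0 \<Longrightarrow> 0 < emeasure M (ball x r) \<and> emeasure M (ball x r) < top"
    and c_gt: "c\<^sub>\<mu> > 1"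
    and doubling: "\<And>(x::'a) r. r > 0 \<Longrightarrow>
           emeasure M (ball x (2 * r)) \<le> ennreal c\<^sub>\<mu> * emeasure M (ball x r)"
    and p: "1 < p"
    and q: "1 \<le> q"
    and \<beta>: "\<beta> > 0"
    and E: "compact E"
  shows "ennpow (potential_cap M \<beta> p q E) (1 / p) =
    (SUP \<nu> \<in> radon_measures E.
       emeasure \<nu> E /
         mixed_norm M (p / (p - 1)) (conj_exponent q) (dual_pot M \<beta> (zero_extension \<nu>)))"
proof -
  let ?I = "scales TYPE('a)"
  \<comment> \<open>Only Borel functions are integrated, so \<open>M\<close> may be replaced by its restriction to the Borel sets.\<close>
  define M' where "M' = distr M borel (\<lambda>x. x)"
  have "space borel \<in> sets M" using borel sets.top by blast
  then have sp: "space M = UNIV" using sets.sets_into_space by fastforce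
  have id: "(\<lambda>x. x) \<in> measurable M borel" using borel sp by (auto simp: measurable_def)
  have sub: "g \<in> borel_measurable M" if "g \<in> borel_measurable borel" for g :: "'a \<Rightarrow> ennreal"
    using measurable_comp[OF id that] by (simp add: comp_def)
  have int: "(\<integral>\<^sup>+x. g x \<partial>M') = (\<integral>\<^sup>+x. g x \<partial>M)" if "g \<in> borel_measurable borel" for g
    unfolding M'_def using nn_integral_distr[OF id, of g] that by simp
  have em: "emeasure M' A = emeasure M A" if "A \<in> sets borel" for A
    using that id sp by (simp add: M'_def emeasure_distr)
  have mixed: "mixed_norm M' r k g = mixed_norm M r k g"
    if "\<And>n. n \<in> ?I \<Longrightarrow> g n \<in> borel_measurable borel" for r k and g :: "int \<Rightarrow> 'a \<Rightarrow> ennreal"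
  proof -
    have [measurable]: "(\<lambda>x. lq_norm ?I k (\<lambda>n. g n x)) \<in> borel_measurable borel"
      using that by (rule borel_measurable_mixed_inner)
    show ?thesis unfolding mixed_norm_def Lp_norm_def by (subst int) auto
  qed
  have pot: "pot M' \<beta> f x = pot M \<beta> f x" if f: "\<And>n. n \<in> ?I \<Longrightarrow> f n \<in> borel_measurable borel" for f x
  proof -
    have "(\<integral>\<^sup>+y. indicator (ball y (2 powi (- n))) x / emeasure M' (ball y (2 powi (- n))) * f n y \<partial>M')
       = (\<integral>\<^sup>+y. indicator (ball y (2 powi (- n))) x / emeasure M (ball y (2 powi (- n))) * f n y \<partial>M)" if n: "n \<in> ?I" for n
    proof -
      have [measurable]: "(\<lambda>y. emeasure M (ball y (2 powi (- n)))) \<in> borel_measurable borel" "f n \<in> borel_measurable borel"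
        using borel_measurable_emeasure_ball[OF borel] f[OF n] by auto
      have "indicator (ball y (2 powi (- n))) x = (indicator (ball x (2 powi (- n))) y :: ennreal)" for y
        by (auto simp: indicator_def dist_commute)
      moreover have [measurable]: "ball x (2 powi (- n)) \<in> sets borel" by simp
      ultimately show ?thesis by (subst int) (simp_all add: em)
    qed
    then show ?thesis unfolding pot_def by (auto intro!: nn_integral_cong)
  qed
  have dual: "dual_pot M' \<beta> N = dual_pot M \<beta> N" for N
    by (auto simp: dual_pot_def[abs_def] em)
  have cap: "potential_cap M' \<beta> p q E = potential_cap M \<beta> p q E"
    unfolding potential_cap_def by (intro INF_cong) (auto simp: pot mixed)
  \<comment> \<open>Masses of balls of fixed radius are Borel functions of the centre, so
    \<open>mixed\<close> applies to dual potentials.\<close>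
  have dm: "dual_pot M \<beta> (zero_extension \<nu>) n \<in> borel_measurable borel" for \<nu> n
    using borel_measurable_emeasure_ball[of "zero_extension \<nu>"] borel_measurable_emeasure_ball[OF borel]
    unfolding dual_pot_def[abs_def] by (simp add: zero_extension_def)
  interpret doubling_borel M' c\<^sub>\<mu>
  proof
    show "sets M' = sets borel" by (simp add: M'_def)
    show "0 < emeasure M' (ball x r) \<and> emeasure M' (ball x r) < top" if "0 < r" for x r
      using balls[OF that] by (simp add: em)
    show "emeasure M' (ball x (2 * r)) \<le> ennreal c\<^sub>\<mu> * emeasure M' (ball x r)" if "0 < r" for x r
      using doubling[OF that] by (simp add: em)
  qed
  show ?thesis
    using potential_cap_dual[OF E p q, of \<beta>] by (simp add: cap dual mixed[OF dm])
qed

end
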